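(* For each $n\ge1$ let $X^{(n)}(\cdot)=(X^{(n)}_i(\cdot))_{i=1}^\infty$ be a stochastic fragmentation process with values in $\mathbb S^{\downarrow}$, and suppose that $X^{(n)}(\cdot)$ converges to $X(\cdot)$ in the sense of finite-dimensional distributions, for some stochastic process $X(\cdot)$ with sample paths in $D(\mathbb R_+,\mathbb S^{\downarrow})$. Define $$Q^{(n)}(t):=\sum_{i=1}^\infty \bigl(X_i^{(n)}(t)\bigr)^2,\qquad t\ge 0,$$ and assume $Q^{(n)}(0)<\infty$ for every $n$. Suppose that for every uniformly bounded sequence $(\tau_n)$ where each $\tau_n$ is an $X^{(n)}$-stopping time, and every sequence $(h_n)$ of positive numbers with $h_n\to0$, we have, as $n\to\infty$, $$Q^{(n)}(\tau_n)-Q^{(n)}(\tau_n+h_n)\to 0\quad\text{in probability}$$ (or the stronger condition $\mathbb E\,Q^{(n)}(\tau_n)-\mathbb E\,Q^{(n)}(\tau_n+h_n)\to0$, where the left-hand side is assumed not to be of the form $\infty-\infty$). Then $X^{(n)}(\cdot)\to X(\cdot)$ in distribution in $D(\mathbb R_+,\mathbb S^{\downarrow})$.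
   Context: $\mathbb R_+:=[0,\infty)$, $\mathbb N:=\{1,2,3,\dots\}$. $\mathbb S^{\downarrow}:=\{(x_i)_{i=1}^\infty: x_i\in\mathbb R,\ x_1\ge x_2\ge\dots\ge0\}$, equipped with the product topology (as a subspace of $\mathbb R^\infty$), generated e.g. by the complete separable metric $d((x_i),(y_i))=\sum_{i\ge1}2^{-i}\min(|x_i-y_i|,1)$. Partial order on $\mathbb S^{\downarrow}$: $(y_i)_{1}^\infty\preceq(x_i)_{1}^\infty$ iff there exists $\alpha:\mathbb N\to\mathbb N$ such that $\sum_{j:\alpha(j)=i}y_j\le x_i$ for all $i\in\mathbb N$. A fragmentation process is a (deterministic or random) function $X(\cdot)=(X_i(\cdot))_{i=1}^\infty:\mathbb R_+\to\mathbb S^{\downarrow}$ that is càdlàg for the product topology and satisfies $X(t_2)\preceq X(t_1)$ whenever $0\le t_1\le t_2$. No other property (e.g. Markov) is assumed. An $X$-stopping time is a random time that is a stopping time for the natural filtration $\mathcal F_t=\sigma\{X(s):s\le t\}$, $t\ge0$. $D(\mathbb R_+,\mathbb S^{\downarrow})$ is the space of càdlàg functions $\mathbb R_+\to\mathbb S^{\downarrow}$ with the Skorohod $J_1$ topology. Finite-dimensional convergence of $X^{(n)}(\cdot)$ to $X(\cdot)$ means that $(X^{(n)}(t_i))_{i=1}^m\to(X(t_i))_{i=1}^m$ in distribution for every fixed finite sequence $t_1,\dots,t_m\in\mathbb R_+$. *)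

theory Defs
  imports "HOL-Probability.Probability"
begin

section \<open>Decreasing sequences and the fragmentation order\<close>

text \<open>Sequences are indexed from 0. The topology on \<^typ>\<open>nat \<Rightarrow> real\<close> is the product topology,
  metrized by \<^const>\<open>dist\<close> as in \<open>dist_fun_def\<close>, and \<^const>\<open>borel\<close> is its Borel sigma-algebra.\<close>

definition Sdown :: "(nat \<Rightarrow> real) set" where
  "Sdown = {x. decseq x \<and> (\<forall>i. 0 \<le> x i)}"

definition frag_le :: "(nat \<Rightarrow> real) \<Rightarrow> (nat \<Rightarrow> real) \<Rightarrow> bool" where
  "frag_le y x \<longleftrightarrow> (\<exists>\<alpha> :: nat \<Rightarrow> nat. \<forall>i. (\<Sum>\<^sub>\<infinity> j\<in>{j. \<alpha> j = i}. ennreal (y j)) \<le> ennreal (x i))"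

definition sum_squares :: "(nat \<Rightarrow> real) \<Rightarrow> ennreal" where
  "sum_squares x = (\<Sum>i. ennreal ((x i)\<^sup>2))"

section \<open>The space of cadlag paths and the Skorohod J1 topology\<close>

text \<open>A path on the half-line is a function on \<^typ>\<open>real\<close> that is \<^const>\<open>undefined\<close> at negative times.\<close>

definition cadlag_paths :: "'b::topological_space set \<Rightarrow> (real \<Rightarrow> 'b) set" where
  "cadlag_paths S = {x \<in> {0..} \<rightarrow>\<^sub>E S. \<forall>t\<ge>0. (x \<longlongrightarrow> x t) (at_right t) \<and>
     (0 < t \<longrightarrow> (\<exists>l\<in>S. (x \<longlongrightarrow> l) (at_left t)))}"

definition time_changes :: "(real \<Rightarrow> real) set" where
  "time_changes = {l. strict_mono_on {0..} l \<and> l ` {0..} = {0..}}"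

definition skorohod_nbhd ::
    "'b::metric_space set \<Rightarrow> (real \<Rightarrow> 'b) \<Rightarrow> real \<Rightarrow> real \<Rightarrow> (real \<Rightarrow> 'b) set" where
  "skorohod_nbhd S x T e = {y \<in> cadlag_paths S.
     \<exists>l\<in>time_changes. \<forall>s\<in>{0..T}. \<bar>l s - s\<bar> < e \<and> dist (y (l s)) (x s) < e}"

text \<open>The J1 topology is metrizable, so it is determined by its convergent sequences; that these
  are the usual ones (uniform convergence on compacts after time changes tending to the identity)
  is \<open>limitin_skorohod_iff\<close> below.\<close>

definition skorohod_topology :: "'b::metric_space set \<Rightarrow> (real \<Rightarrow> 'b) topology" where
  "skorohod_topology S = topology (\<lambda>U. U \<subseteq> cadlag_paths S \<and>
     (\<forall>x\<in>U. \<exists>T>0. \<exists>e>0. skorohod_nbhd S x T e \<subseteq> U))"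

lemma skorohod_nbhd_mono:
  assumes "T' \<le> T" "e \<le> e'"
  shows "skorohod_nbhd S x T e \<subseteq> skorohod_nbhd S x T' e'"
proof
  fix y assume "y \<in> skorohod_nbhd S x T e"
  then obtain l where y: "y \<in> cadlag_paths S" "l \<in> time_changes"
    and l: "\<And>s. s \<in> {0..T} \<Longrightarrow> \<bar>l s - s\<bar> < e \<and> dist (y (l s)) (x s) < e"
    unfolding skorohod_nbhd_def by blast
  have "\<bar>l s - s\<bar> < e' \<and> dist (y (l s)) (x s) < e'" if "s \<in> {0..T'}" for s
    using l[of s] that assms by auto
  then show "y \<in> skorohod_nbhd S x T' e'"
    using y unfolding skorohod_nbhd_def by blast
qed

lemma openin_skorohod_topology:
  "openin (skorohod_topology S) U \<longleftrightarrow> U \<subseteq> cadlag_paths S \<and>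
     (\<forall>x\<in>U. \<exists>T>0. \<exists>e>0. skorohod_nbhd S x T e \<subseteq> U)"
proof -
  let ?P = "\<lambda>U. U \<subseteq> cadlag_paths S \<and> (\<forall>x\<in>U. \<exists>T>0. \<exists>e>0. skorohod_nbhd S x T e \<subseteq> U)"
  have "?P (U \<inter> V)" if U: "?P U" and V: "?P V" for U V
  proof (intro conjI ballI)
    show "U \<inter> V \<subseteq> cadlag_paths S" using U by auto
    fix x assume "x \<in> U \<inter> V"
    then obtain T1 e1 T2 e2 where *: "T1 > 0" "e1 > 0" "skorohod_nbhd S x T1 e1 \<subseteq> U"
      "T2 > 0" "e2 > 0" "skorohod_nbhd S x T2 e2 \<subseteq> V"
      using U V by (meson IntE)
    have "skorohod_nbhd S x (max T1 T2) (min e1 e2) \<subseteq> U \<inter> V"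
      using skorohod_nbhd_mono[of T1 "max T1 T2" "min e1 e2" e1 S x]
        skorohod_nbhd_mono[of T2 "max T1 T2" "min e1 e2" e2 S x] * by auto
    then show "\<exists>T>0. \<exists>e>0. skorohod_nbhd S x T e \<subseteq> U \<inter> V"
      using * by (metis less_max_iff_disj min_less_iff_conj)
  qed
  moreover have "?P (\<Union>K)" if "\<forall>U\<in>K. ?P U" for K
  proof (intro conjI ballI)
    show "\<Union>K \<subseteq> cadlag_paths S" using that by blast
    fix x assume "x \<in> \<Union>K"
    then obtain U where U: "U \<in> K" "x \<in> U" by blast
    then have "\<exists>T>0. \<exists>e>0. skorohod_nbhd S x T e \<subseteq> U" using that by simp
    then show "\<exists>T>0. \<exists>e>0. skorohod_nbhd S x T e \<subseteq> \<Union>K" using U(1) by (meson Union_upper subset_trans)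
  qed
  ultimately have "istopology ?P" unfolding istopology_def by blast
  then show ?thesis unfolding skorohod_topology_def by (simp add: topology_inverse')
qed

lemma topspace_skorohod_topology [simp]: "topspace (skorohod_topology S) = cadlag_paths S"
proof -
  have "openin (skorohod_topology S) (cadlag_paths S)"
    unfolding openin_skorohod_topology
    by (auto simp: skorohod_nbhd_def intro!: exI[of _ 1])
  then show ?thesis
    by (meson openin_skorohod_topology openin_subset openin_topspace subset_antisym)
qed

lemma id_time_change: "(\<lambda>s. s) \<in> time_changes"
  by (simp add: time_changes_def strict_mono_on_def)

lemma skorohod_nbhd_centre: "x \<in> cadlag_paths S \<Longrightarrow> e > 0 \<Longrightarrow> x \<in> skorohod_nbhd S x T e"
  unfolding skorohod_nbhd_def using id_time_change by (auto intro!: bexI[of _ "\<lambda>s. s"])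

lemma time_changes_comp:
  assumes "l \<in> time_changes" "m \<in> time_changes"
  shows "(\<lambda>s. m (l s)) \<in> time_changes"
proof -
  have "(\<lambda>s. m (l s)) ` {0..} = m ` (l ` {0..})" by auto
  also have "\<dots> = {0..}" using assms unfolding time_changes_def by simp
  finally have "(\<lambda>s. m (l s)) ` {0..} = {0..}" .
  moreover have "m (l r) < m (l s)" if "0 \<le> r" "r < s" for r s
  proof -
    have "l r \<in> {0..}" "l s \<in> {0..}" using assms(1) that unfolding time_changes_def by auto
    moreover have "l r < l s"
      using assms(1) that unfolding time_changes_def strict_mono_on_def by auto
    ultimately show ?thesis
      using assms(2) unfolding time_changes_def strict_mono_on_def by blast
  qed
  ultimately show ?thesis unfolding time_changes_def strict_mono_on_def by auto
qed

lemma skorohod_nbhd_triangle: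
  assumes y: "y \<in> skorohod_nbhd S x T d" and z: "z \<in> skorohod_nbhd S y (T + d) d'"
  shows "z \<in> skorohod_nbhd S x T (d + d')"
proof -
  obtain l where l: "l \<in> time_changes"
    "\<And>s. s \<in> {0..T} \<Longrightarrow> \<bar>l s - s\<bar> < d \<and> dist (y (l s)) (x s) < d"
    using y unfolding skorohod_nbhd_def by blast
  obtain m where m: "m \<in> time_changes"
    "\<And>s. s \<in> {0..T + d} \<Longrightarrow> \<bar>m s - s\<bar> < d' \<and> dist (z (m s)) (y s) < d'"
    using z unfolding skorohod_nbhd_def by blast
  have "\<bar>m (l s) - s\<bar> < d + d' \<and> dist (z (m (l s))) (x s) < d + d'" if s: "s \<in> {0..T}" for s
  proof -
    have "0 \<le> l s" using l(1) s unfolding time_changes_def by auto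
    moreover have "l s \<le> T + d" using l(2)[OF s] s by auto
    ultimately have "\<bar>m (l s) - l s\<bar> < d' \<and> dist (z (m (l s))) (y (l s)) < d'"
      using m(2) by auto
    then show ?thesis
      using l(2)[OF s] dist_triangle[of "z (m (l s))" "x s" "y (l s)"] by linarith
  qed
  then show ?thesis
    using time_changes_comp[OF l(1) m(1)] z unfolding skorohod_nbhd_def
    by (auto intro!: bexI[of _ "\<lambda>s. m (l s)"])
qed

lemma limitin_skorohod_nbhd:
  "limitin (skorohod_topology S) y x F \<longleftrightarrow>
     x \<in> cadlag_paths S \<and> (\<forall>T. \<forall>e>0. \<forall>\<^sub>F n in F. y n \<in> skorohod_nbhd S x T e)"
    (is "?lhs \<longleftrightarrow> ?rhs")
proof
  assume L: ?lhs
  then have x: "x \<in> cadlag_paths S" by (simp add: limitin_def)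
  have "\<forall>\<^sub>F n in F. y n \<in> skorohod_nbhd S x T e" if e: "e > 0" for T e
  proof -
    define W where "W = {z \<in> cadlag_paths S. \<exists>R>0. \<exists>d>0.
      skorohod_nbhd S z R d \<subseteq> skorohod_nbhd S x T e}"
    have "openin (skorohod_topology S) W"
      unfolding openin_skorohod_topology
    proof (intro conjI ballI)
      show "W \<subseteq> cadlag_paths S" by (auto simp: W_def)
      fix z assume "z \<in> W"
      then obtain R d where z: "z \<in> cadlag_paths S" "R > 0" "d > 0"
        "skorohod_nbhd S z R d \<subseteq> skorohod_nbhd S x T e" by (auto simp: W_def)
      have "w \<in> W" if w: "w \<in> skorohod_nbhd S z R (d/2)" for w
      proof -
        have "skorohod_nbhd S w (R + d/2) (d/2) \<subseteq> skorohod_nbhd S x T e"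
          using skorohod_nbhd_triangle[OF w, of _ "d/2"] z(4) by auto
        then show ?thesis
          using w z(2,3) unfolding W_def skorohod_nbhd_def[of S z]
          by (metis (mono_tags, lifting) add_pos_pos half_gt_zero mem_Collect_eq)
      qed
      then show "\<exists>R>0. \<exists>d>0. skorohod_nbhd S z R d \<subseteq> W"
        using z(2,3) by (intro exI[of _ R] exI[of _ "d/2"] conjI subsetI) auto
    qed
    moreover have "x \<in> W"
    proof -
      have "skorohod_nbhd S x (max T 1) e \<subseteq> skorohod_nbhd S x T e"
        by (rule skorohod_nbhd_mono) auto
      moreover have "max T 1 > 0" by simp
      ultimately show ?thesis unfolding W_def using x e by blast
    qed
    ultimately have "\<forall>\<^sub>F n in F. y n \<in> W" using L by (auto simp: limitin_def)
    then show ?thesis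
    proof eventually_elim
      case (elim n)
      then show ?case using skorohod_nbhd_centre unfolding W_def by blast
    qed
  qed
  with x show ?rhs by blast
next
  assume R: ?rhs
  show ?lhs
    unfolding limitin_def topspace_skorohod_topology
  proof (intro conjI allI impI)
    show "x \<in> cadlag_paths S" using R by blast
    fix U assume "openin (skorohod_topology S) U \<and> x \<in> U"
    then obtain T e where "e > 0" "skorohod_nbhd S x T e \<subseteq> U"
      unfolding openin_skorohod_topology by blast
    moreover have "\<forall>\<^sub>F n in F. y n \<in> skorohod_nbhd S x T e" using R \<open>e > 0\<close> by blast
    ultimately show "\<forall>\<^sub>F n in F. y n \<in> U" by (auto elim: eventually_mono)
  qed
qed

theorem limitin_skorohod_iff:
  "limitin (skorohod_topology S) y x sequentially \<longleftrightarrow>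
     x \<in> cadlag_paths S \<and> (\<forall>\<^sub>F n in sequentially. y n \<in> cadlag_paths S) \<and>
     (\<exists>l. (\<forall>n. l n \<in> time_changes) \<and>
        (\<forall>T. uniform_limit {0..T} l (\<lambda>s. s) sequentially \<and>
             uniform_limit {0..T} (\<lambda>n s. y n (l n s)) x sequentially))"
    (is "?lhs \<longleftrightarrow> ?rhs")
proof
  assume ?lhs
  then have x: "x \<in> cadlag_paths S"
    and ev: "\<And>T e. e > 0 \<Longrightarrow> \<forall>\<^sub>F n in sequentially. y n \<in> skorohod_nbhd S x T e"
    by (auto simp: limitin_skorohod_nbhd)
  define N where "N k = skorohod_nbhd S x (real k) (1 / real (Suc k))" for k
  define close where "close k n l \<longleftrightarrow> (\<forall>s\<in>{0..real k}.
    \<bar>l s - s\<bar> < 1 / real (Suc k) \<and> dist (y n (l s)) (x s) < 1 / real (Suc k))" for k n l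
  have close_mono: "close j n l" if "close k n l" "j \<le> k" for j k n l
  proof -
    have "1 / real (Suc k) \<le> 1 / real (Suc j)" using that(2) by (simp add: frac_le)
    moreover have "s \<in> {0..real k}" if "s \<in> {0..real j}" for s
      using that \<open>j \<le> k\<close> by auto
    ultimately show ?thesis using that(1) unfolding close_def by (meson less_le_trans)
  qed
  have "\<exists>l\<in>time_changes. \<forall>k\<le>n. y n \<in> N k \<longrightarrow> close k n l" for n
  proof (cases "\<exists>k\<le>n. y n \<in> N k")
    case True
    define k where "k = Max {k. k \<le> n \<and> y n \<in> N k}"
    have fin: "finite {k. k \<le> n \<and> y n \<in> N k}" by simp
    have "k \<in> {k. k \<le> n \<and> y n \<in> N k}"
      unfolding k_def using True by (intro Max_in fin) auto
    then obtain l where l: "l \<in> time_changes" "close k n l"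
      unfolding N_def skorohod_nbhd_def close_def by blast
    have "j \<le> k" if "j \<le> n" "y n \<in> N j" for j
      unfolding k_def using that by (intro Max_ge fin) auto
    then show ?thesis using l close_mono by blast
  next
    case False
    then show ?thesis using id_time_change by blast
  qed
  then obtain l where l: "\<And>n. l n \<in> time_changes"
    "\<And>n k. k \<le> n \<Longrightarrow> y n \<in> N k \<Longrightarrow> close k n (l n)" by metis
  have "\<forall>\<^sub>F n in sequentially. \<forall>s\<in>{0..T}. \<bar>l n s - s\<bar> < e \<and> dist (y n (l n s)) (x s) < e"
    if e: "e > 0" for T e
  proof -
    obtain k1 where k1: "1 / real (Suc k1) < e" using e nat_approx_posE by blast
    obtain k2 where k2: "T \<le> real k2" using real_arch_simple by blast
    define k where "k = max k1 k2"
    have "1 / real (Suc k) \<le> 1 / real (Suc k1)" unfolding k_def by (simp add: frac_le)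
    then have k: "1 / real (Suc k) < e" "T \<le> real k" using k1 k2 unfolding k_def by auto
    have "\<forall>\<^sub>F n in sequentially. y n \<in> N k" unfolding N_def by (rule ev) simp
    then have "\<forall>\<^sub>F n in sequentially. close k n (l n)"
      using eventually_ge_at_top[of k] by eventually_elim (rule l(2))
    then show ?thesis
    proof eventually_elim
      case (elim n)
      show ?case
      proof
        fix s assume "s \<in> {0..T}"
        then have "s \<in> {0..real k}" using k(2) by auto
        then show "\<bar>l n s - s\<bar> < e \<and> dist (y n (l n s)) (x s) < e"
          using elim k(1) unfolding close_def by (meson less_trans)
      qed
    qed
  qed
  note lim = this
  have "\<forall>T. uniform_limit {0..T} l (\<lambda>s. s) sequentially \<and>
      uniform_limit {0..T} (\<lambda>n s. y n (l n s)) x sequentially"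
    unfolding uniform_limit_iff dist_real_def
  proof (intro allI conjI impI)
    fix T e :: real assume "e > 0"
    show "\<forall>\<^sub>F n in sequentially. \<forall>s\<in>{0..T}. \<bar>l n s - s\<bar> < e"
      using lim[OF \<open>e > 0\<close>, of T] by (rule eventually_mono) blast
    show "\<forall>\<^sub>F n in sequentially. \<forall>s\<in>{0..T}. dist (y n (l n s)) (x s) < e"
      using lim[OF \<open>e > 0\<close>, of T] by (rule eventually_mono) blast
  qed
  moreover have "\<forall>\<^sub>F n in sequentially. y n \<in> cadlag_paths S"
    using ev[of 1 0] by (auto simp: skorohod_nbhd_def elim: eventually_mono)
  ultimately show ?rhs using x l(1) by blast
next
  assume ?rhs
  then obtain l where x: "x \<in> cadlag_paths S"
    and y: "\<forall>\<^sub>F n in sequentially. y n \<in> cadlag_paths S"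
    and l: "\<And>n. l n \<in> time_changes"
    and u: "\<And>T. uniform_limit {0..T} l (\<lambda>s. s) sequentially"
      "\<And>T. uniform_limit {0..T} (\<lambda>n s. y n (l n s)) x sequentially" by blast
  have "\<forall>\<^sub>F n in sequentially. y n \<in> skorohod_nbhd S x T e" if "e > 0" for T e
    using y uniform_limitD[OF u(1) that, of T] uniform_limitD[OF u(2) that, of T]
    by eventually_elim (use l in \<open>auto simp: skorohod_nbhd_def dist_real_def\<close>)
  with x show ?lhs by (auto simp: limitin_skorohod_nbhd)
qed

section \<open>Stochastic processes and modes of convergence\<close>

definition sample_path :: "(real \<Rightarrow> 'w \<Rightarrow> 'b) \<Rightarrow> 'w \<Rightarrow> (real \<Rightarrow> 'b)" where
  "sample_path X \<omega> = (\<lambda>t\<in>{0..}. X t \<omega>)"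

definition cadlag_process ::
    "'w measure \<Rightarrow> 'b::topological_space set \<Rightarrow> (real \<Rightarrow> 'w \<Rightarrow> 'b) \<Rightarrow> bool" where
  "cadlag_process M S X \<longleftrightarrow> (\<forall>t\<ge>0. X t \<in> borel_measurable M) \<and>
     (\<forall>\<omega>\<in>space M. sample_path X \<omega> \<in> cadlag_paths S)"

definition fragmentation_process :: "'w measure \<Rightarrow> (real \<Rightarrow> 'w \<Rightarrow> (nat \<Rightarrow> real)) \<Rightarrow> bool" where
  "fragmentation_process M X \<longleftrightarrow> cadlag_process M Sdown X \<and>
     (\<forall>\<omega>\<in>space M. \<forall>t\<^sub>1 t\<^sub>2. 0 \<le> t\<^sub>1 \<and> t\<^sub>1 \<le> t\<^sub>2 \<longrightarrow> frag_le (X t\<^sub>2 \<omega>) (X t\<^sub>1 \<omega>))"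

text \<open>For negative \<open>t\<close> this is the trivial sigma-algebra, so that \<^const>\<open>stopping_time\<close> puts no
  constraint on nonnegative random times there.\<close>

definition natural_filtration ::
    "'w measure \<Rightarrow> (real \<Rightarrow> 'w \<Rightarrow> 'b::topological_space) \<Rightarrow> real \<Rightarrow> 'w measure" where
  "natural_filtration M X t =
     sigma (space M) {X s -` B \<inter> space M | s B. s \<in> {0..t} \<and> B \<in> sets borel}"

definition borel_of :: "'b topology \<Rightarrow> 'b measure" where
  "borel_of T = sigma (topspace T) {U. openin T U}"

definition converges_in_distribution ::
    "'b topology \<Rightarrow> (nat \<Rightarrow> 'w measure) \<Rightarrow> (nat \<Rightarrow> 'w \<Rightarrow> 'b) \<Rightarrow> 'v measure \<Rightarrow> ('v \<Rightarrow> 'b) \<Rightarrow> bool" where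
  "converges_in_distribution T M Y N Z \<longleftrightarrow>
     (\<forall>n. Y n \<in> M n \<rightarrow>\<^sub>M borel_of T) \<and> Z \<in> N \<rightarrow>\<^sub>M borel_of T \<and>
     (\<forall>f :: 'b \<Rightarrow> real. continuous_map T euclideanreal f \<and> bounded (f ` topspace T) \<longrightarrow>
        (\<lambda>n. \<integral>\<omega>. f (Y n \<omega>) \<partial>M n) \<longlonglongrightarrow> (\<integral>\<omega>. f (Z \<omega>) \<partial>N))"

definition converges_in_fdd ::
    "'b::topological_space set \<Rightarrow> (nat \<Rightarrow> 'w measure) \<Rightarrow> (nat \<Rightarrow> real \<Rightarrow> 'w \<Rightarrow> 'b) \<Rightarrow>
     'v measure \<Rightarrow> (real \<Rightarrow> 'v \<Rightarrow> 'b) \<Rightarrow> bool" where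
  "converges_in_fdd S M X N Y \<longleftrightarrow> (\<forall>m (t :: nat \<Rightarrow> real). (\<forall>i<m. 0 \<le> t i) \<longrightarrow>
     converges_in_distribution (product_topology (\<lambda>_. top_of_set S) {..<m})
       M (\<lambda>n \<omega>. \<lambda>i\<in>{..<m}. X n (t i) \<omega>) N (\<lambda>\<omega>. \<lambda>i\<in>{..<m}. Y (t i) \<omega>))"

definition tends_to_0_in_probability :: "(nat \<Rightarrow> 'w measure) \<Rightarrow> (nat \<Rightarrow> 'w \<Rightarrow> real) \<Rightarrow> bool" where
  "tends_to_0_in_probability M Z \<longleftrightarrow>
     (\<forall>e>0. (\<lambda>n. measure (M n) {\<omega> \<in> space (M n). e < \<bar>Z n \<omega>\<bar>}) \<longlonglongrightarrow> 0)"

end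

theory Submission
  imports Defs
begin

text \<open>
  The sum of squares \<open>Q\<close> turns an infinite-dimensional path into a decreasing real function that
  controls it: a fragmentation that lowers \<open>Q\<close> by less than \<open>e\<^sup>2\<close> moves every coordinate of the ranked
  sequence by at most \<open>e\<close> (\<open>frag_le_coordinate_gap\<close>). Between two successive times at which \<open>Q\<close> has
  dropped by more than a small \<open>\<eta>\<close>, the path therefore hardly moves, and all that can go wrong is that such
  drop times come in quick succession.

  The stopping time condition excludes this, in the manner of Aldous. It is first made uniform over all
  stopping times with finitely many values (\<open>uniformly_small_drops\<close>). Applied to the successive drop
  times, it says that a gap below \<open>\<delta>\<close> is unlikely, because \<open>Q\<close> is monotone: a drop within \<open>\<delta>\<close> after a
  stopping time is still visible at lag exactly \<open>\<delta>\<close> (\<open>probability_early_short_gap\<close>). Counting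
  short gaps bounds the number of drops before a given time, and a second, smaller \<open>\<delta>\<close> separates all of
  them (\<open>probability_discretizations_close\<close>).

  Convergence in law is then derived by discretization. Sampling a
  path on the grid of mesh \<open>1 / k\<close> moves it little in the J1 topology as soon as its large
  oscillations are at least \<open>1 / k\<close> apart (\<open>discretize_nbhd_of_partition\<close>). With high probability this holds
  for all \<open>X n\<close> with \<open>n\<close> large and the same \<open>k\<close>, while the sampled paths are functions of finitely many
  marginals and so converge by hypothesis. This settles all bounded uniformly continuous functionals
  (\<open>skorohod_ucont_integral_convergence\<close>). A bounded continuous functional is both a limit from below and
  a limit from above of uniformly continuous ones (\<open>skorohod_lsc_approx\<close>), which gives the two
  inequalities for its expectations (\<open>skorohod_convergence_of_ucont\<close>).

  The drop times are taken on a grid finer than \<open>1 / k\<close>, and the path is sampled on that finer grid as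
  well. The grid makes them stopping times of the raw natural filtration, and they control the
  sampled path exactly; the mesh of the finer grid is sent to 0 afterwards, for each fixed \<open>n\<close>.
\<close>

section \<open>Fragmentation and the sum of squares\<close>

lemma infsum_ennreal_eq_suminf:
  fixes f :: "nat \<Rightarrow> ennreal"
  shows "(\<Sum>\<^sub>\<infinity>j\<in>A. f j) = (\<Sum>j. if j \<in> A then f j else 0)"
proof -
  have "(\<Sum>\<^sub>\<infinity>j\<in>A. f j) = (\<Sum>\<^sub>\<infinity>j. if j \<in> A then f j else 0)"
    by (rule infsum_cong_neutral) auto
  moreover have "((\<lambda>j. if j \<in> A then f j else 0) has_sum (\<Sum>\<^sub>\<infinity>j. if j \<in> A then f j else 0)) UNIV"
    by (rule has_sum_infsum) (simp add: nonneg_summable_on_complete)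
  ultimately show ?thesis
    by (metis has_sum_imp_sums sums_unique)
qed

lemma suminf_swap_ennreal:
  fixes f :: "nat \<Rightarrow> nat \<Rightarrow> ennreal"
  shows "(\<Sum>i. \<Sum>j. f i j) = (\<Sum>j. \<Sum>i. f i j)"
  using nn_integral_suminf[of f "count_space UNIV"]
  by (simp add: nn_integral_count_space_nat)

lemma suminf_single_ennreal:
  "(\<Sum>i. if i = k then c else 0 :: ennreal) = c"
  using suminf_finite[of "{k}" "\<lambda>i. if i = k then c else 0 :: ennreal"] by simp

text \<open>If every fragment of block \<open>k\<close> has size at most \<open>m\<close>, then the squares of these fragments sum
  to at most \<open>m * x k\<close>, because the fragments themselves sum to at most \<open>x k\<close>. Hence that block
  alone loses \<open>x k * (x k - m) \<ge> (x k - m)\<^sup>2\<close>, while no other block can gain. Think of \<open>m\<close> as the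
  largest fragment of the block, or as 0 if the block has no fragments.\<close>

lemma sum_squares_frag_gap:
  assumes y0: "\<And>j. 0 \<le> y j" and x0: "\<And>i. 0 \<le> x i"
    and \<alpha>: "\<And>i. (\<Sum>j. if \<alpha> j = i then ennreal (y j) else 0) \<le> ennreal (x i)"
    and m: "\<And>j. \<alpha> j = k \<Longrightarrow> y j \<le> m" "0 \<le> m" "m \<le> x k"
  shows "sum_squares y + ennreal ((x k - m)\<^sup>2) \<le> sum_squares x"
proof -
  define D where "D i = (\<Sum>j. if \<alpha> j = i then ennreal ((y j)\<^sup>2) else 0)" for i
  have Dle: "D i \<le> ennreal (c * x i)" if c: "0 \<le> c" "\<And>j. \<alpha> j = i \<Longrightarrow> y j \<le> c" for i c
  proof -
    have "D i \<le> (\<Sum>j. ennreal c * (if \<alpha> j = i then ennreal (y j) else 0))"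
      unfolding D_def
    proof (rule suminf_le)
      fix j
      show "(if \<alpha> j = i then ennreal ((y j)\<^sup>2) else 0) \<le> ennreal c * (if \<alpha> j = i then ennreal (y j) else 0)"
        using c y0[of j] by (auto simp: ennreal_mult[symmetric] power2_eq_square intro!: ennreal_leI mult_right_mono)
    qed auto
    also have "\<dots> = ennreal c * (\<Sum>j. if \<alpha> j = i then ennreal (y j) else 0)" by simp
    also have "\<dots> \<le> ennreal c * ennreal (x i)" by (intro mult_left_mono \<alpha>) auto
    finally show ?thesis using c x0 by (simp add: ennreal_mult)
  qed
  have piece: "y j \<le> x i" if "\<alpha> j = i" for i j
  proof -
    have "(\<Sum>j'. if j' = j then ennreal (y j) else 0) \<le> (\<Sum>j. if \<alpha> j = i then ennreal (y j) else 0)"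
      using that by (intro suminf_le) auto
    then have "ennreal (y j) \<le> ennreal (x i)" using \<alpha>[of i] by (simp add: suminf_single_ennreal)
    then show ?thesis using x0[of i] by simp
  qed
  have "sum_squares y = (\<Sum>j. \<Sum>i. if i = \<alpha> j then ennreal ((y j)\<^sup>2) else 0)"
    unfolding sum_squares_def by (simp add: suminf_single_ennreal)
  also have "\<dots> = (\<Sum>i. \<Sum>j. if i = \<alpha> j then ennreal ((y j)\<^sup>2) else 0)"
    by (rule suminf_swap_ennreal)
  also have "\<dots> = (\<Sum>i. D i)"
    unfolding D_def by (intro suminf_cong) (auto intro!: suminf_cong)
  finally have "sum_squares y + ennreal ((x k - m)\<^sup>2)
      = (\<Sum>i. D i + (if i = k then ennreal ((x k - m)\<^sup>2) else 0))"
    by (simp add: suminf_add[symmetric] suminf_single_ennreal)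
  also have "\<dots> \<le> (\<Sum>i. ennreal ((x i)\<^sup>2))"
  proof (intro suminf_le)
    fix i
    show "D i + (if i = k then ennreal ((x k - m)\<^sup>2) else 0) \<le> ennreal ((x i)\<^sup>2)"
    proof (cases "i = k")
      case True
      have "D i + ennreal ((x k - m)\<^sup>2) \<le> ennreal (m * x k) + ennreal ((x k - m)\<^sup>2)"
        using Dle[of m i] m True by (intro add_right_mono) auto
      also have "\<dots> = ennreal (m * x k + (x k - m)\<^sup>2)"
        using m x0[of k] by (simp add: ennreal_plus)
      also have "m * x k + (x k - m)\<^sup>2 \<le> (x k)\<^sup>2"
        using mult_left_mono[OF m(3,2)] by (simp add: power2_eq_square algebra_simps)
      finally show ?thesis using True by (simp add: ennreal_leI)
    next
      case False
      then show ?thesis using Dle[of "x i" i] piece x0[of i] by (simp add: power2_eq_square)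
    qed
  qed auto
  finally show ?thesis unfolding sum_squares_def .
qed

lemma frag_le_sum_squares_mono:
  assumes x: "x \<in> Sdown" and y: "y \<in> Sdown" and le: "frag_le y x"
  shows "sum_squares y \<le> sum_squares x"
proof -
  obtain \<alpha> :: "nat \<Rightarrow> nat" where \<alpha>: "\<And>i. (\<Sum>j. if \<alpha> j = i then ennreal (y j) else 0) \<le> ennreal (x i)"
    using le unfolding frag_le_def infsum_ennreal_eq_suminf by auto
  have "y j \<le> x 0" if "\<alpha> j = 0" for j
  proof -
    have "(\<Sum>j'. if j' = j then ennreal (y j) else 0) \<le> (\<Sum>j. if \<alpha> j = 0 then ennreal (y j) else 0)"
      using that by (intro suminf_le) auto
    then have "ennreal (y j) \<le> ennreal (x 0)" using \<alpha>[of 0] by (simp add: suminf_single_ennreal)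
    then show ?thesis using x by (simp add: Sdown_def)
  qed
  from sum_squares_frag_gap[OF _ _ \<alpha> this, of 0] have "sum_squares y + ennreal ((x 0 - x 0)\<^sup>2) \<le> sum_squares x"
    using x y by (simp add: Sdown_def)
  then show ?thesis by simp
qed

text \<open>A small loss of squares moves no coordinate of the ranked sequence by much. Suppose that the loss
  is below \<open>e\<^sup>2\<close>. Every block longer than \<open>e\<close> then keeps a fragment of nearly full length, and if
  \<open>y k\<close> were below \<open>x k - e\<close>, the \<open>k + 1\<close> longest blocks would give \<open>k + 1\<close> fragments larger than \<open>y k\<close>,
  where a decreasing sequence has room for only \<open>k\<close>. If \<open>y k\<close> were above \<open>x k + e\<close>, the \<open>k + 1\<close> largest
  fragments would come from the \<open>k\<close> blocks longer than \<open>x k\<close>, so that two share a block; each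
  fragment there is then at most the block length minus \<open>y k\<close>, which bounds \<open>y k\<close> by \<open>e\<close>.\<close>

lemma frag_le_coordinate_gap:
  assumes x: "x \<in> Sdown" and y: "y \<in> Sdown" and le: "frag_le y x"
    and gap: "sum_squares x < sum_squares y + ennreal (e\<^sup>2)" and e: "0 \<le> e"
  shows "\<bar>x k - y k\<bar> \<le> e"
proof -
  obtain \<alpha> :: "nat \<Rightarrow> nat" where \<alpha>: "\<And>i. (\<Sum>j. if \<alpha> j = i then ennreal (y j) else 0) \<le> ennreal (x i)"
    using le unfolding frag_le_def infsum_ennreal_eq_suminf by auto
  have x0: "0 \<le> x i" and y0: "0 \<le> y i" for i using x y by (auto simp: Sdown_def)
  have xd: "x j \<le> x i" and yd: "y j \<le> y i" if "i \<le> j" for i j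
    using x y that by (auto simp: Sdown_def decseq_def)
  have close: "x i - m \<le> e" if "\<And>j. \<alpha> j = i \<Longrightarrow> y j \<le> m" "0 \<le> m" "m \<le> x i" for i m
  proof (rule ccontr)
    assume "\<not> x i - m \<le> e"
    then have "e\<^sup>2 \<le> (x i - m)\<^sup>2" using e by (intro power_mono) auto
    then have "sum_squares y + ennreal (e\<^sup>2) \<le> sum_squares y + ennreal ((x i - m)\<^sup>2)"
      by (intro add_left_mono ennreal_leI)
    also have "\<dots> \<le> sum_squares x"
      by (rule sum_squares_frag_gap[OF y0 x0 \<alpha> that])
    finally show False using gap by simp
  qed
  have "x k - y k \<le> e"
  proof (rule ccontr)
    assume *: "\<not> x k - y k \<le> e"
    (* Block i has a fragment larger than y k, and such a fragment has rank below k. *)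
    have "\<exists>j. \<alpha> j = i \<and> j < k" if "i \<le> k" for i
    proof -
      have "\<not> x i - y k \<le> e" using xd[OF that] * by auto
      then obtain j where "\<alpha> j = i" "\<not> y j \<le> y k" using close[of i "y k"] y0[of k] e by fastforce
      then show ?thesis using yd[of k j] by force
    qed
    then have "{..k} \<subseteq> \<alpha> ` {..<k}" by force
    then have "card {..k} \<le> card {..<k}" by (meson finite_lessThan surj_card_le)
    then show False by simp
  qed
  moreover have "y k - x k \<le> e"
  proof (rule ccontr)
    assume *: "\<not> y k - x k \<le> e"
    (* Two fragments of the same block fit into it together. *)
    have two: "y j + y j' \<le> x i" if "\<alpha> j = i" "\<alpha> j' = i" "j \<noteq> j'" for i j j'
    proof -
      have "ennreal (y j) + ennreal (y j') = (\<Sum>l. (if l = j then ennreal (y j) else 0) + (if l = j' then ennreal (y j') else 0))"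
        by (simp add: suminf_add[symmetric] suminf_single_ennreal)
      also have "\<dots> \<le> (\<Sum>j. if \<alpha> j = i then ennreal (y j) else 0)"
        using that by (intro suminf_le) auto
      also have "\<dots> \<le> ennreal (x i)" by (rule \<alpha>)
      finally have "ennreal (y j + y j') \<le> ennreal (x i)" by (subst ennreal_plus[OF y0 y0])
      then show ?thesis by (simp only: ennreal_le_iff[OF x0])
    qed
    have one: "y j \<le> x (\<alpha> j)" for j
    proof -
      have "(\<Sum>j'. if j' = j then ennreal (y j) else 0) \<le> (\<Sum>l. if \<alpha> l = \<alpha> j then ennreal (y l) else 0)"
        by (intro suminf_le) auto
      then have "ennreal (y j) \<le> ennreal (x (\<alpha> j))" using \<alpha>[of "\<alpha> j"] by (simp add: suminf_single_ennreal)
      then show ?thesis using x0 by simp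
    qed
    have "\<alpha> j < k" if "j \<le> k" for j
    proof (rule ccontr)
      assume "\<not> \<alpha> j < k"
      then have "x (\<alpha> j) \<le> x k" by (intro xd) auto
      then show False using one[of j] yd[OF that] * e by auto
    qed
    then have "\<alpha> ` {..k} \<subseteq> {..<k}" by auto
    then have "card (\<alpha> ` {..k}) \<le> card {..<k}" by (intro card_mono) auto
    then have "\<not> inj_on \<alpha> {..k}" by (intro pigeonhole) simp
    then obtain a b where ab: "a \<le> k" "b \<le> k" "\<alpha> a = \<alpha> b" "a \<noteq> b" unfolding inj_on_def by blast
    have "y j \<le> x (\<alpha> a) - y k" if "\<alpha> j = \<alpha> a" for j
    proof (cases "j = a")
      case True
      then show ?thesis using two[OF refl ab(3)[symmetric] ab(4)] yd[OF ab(2)] by simp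
    next
      case False
      then show ?thesis using two[OF refl that] yd[OF ab(1)] by fastforce
    qed
    moreover have "0 \<le> x (\<alpha> a) - y k" using one[of a] yd[OF ab(1)] by linarith
    moreover have "x (\<alpha> a) - y k \<le> x (\<alpha> a)" using y0[of k] by linarith
    ultimately have "x (\<alpha> a) - (x (\<alpha> a) - y k) \<le> e" by (rule close)
    then have "y k \<le> e" by linarith
    then show False using * x0[of k] by auto
  qed
  ultimately show ?thesis by auto
qed

lemma dist_le_coordinatewise:
  fixes x y :: "nat \<Rightarrow> real"
  assumes "\<And>k. \<bar>x k - y k\<bar> \<le> e"
  shows "dist x y \<le> 2 * e"
proof -
  have e: "0 \<le> e" using assms[of 0] by auto
  have "(\<Sum>n. (1/2)^n * min (dist (x (from_nat n)) (y (from_nat n))) 1) \<le> (\<Sum>n. (1/2)^n * e)"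
  proof (rule suminf_le)
    show "(1/2)^n * min (dist (x (from_nat n)) (y (from_nat n))) 1 \<le> (1/2)^n * e" for n
      using assms[of "from_nat n"] by (intro mult_left_mono) (auto simp: dist_real_def)
    show "summable (\<lambda>n. (1/2)^n * min (dist (x (from_nat n)) (y (from_nat n))) 1)"
      by (rule summable_comparison_test'[of "\<lambda>n. (1/2)^n"]) (auto simp: summable_geometric_iff)
    show "summable (\<lambda>n. (1/2)^n * e)" by (intro summable_mult2) (auto simp: summable_geometric_iff)
  qed
  also have "\<dots> = 2 * e" by (subst suminf_mult2[symmetric]) (auto simp: suminf_geometric)
  finally show ?thesis unfolding dist_fun_def .
qed

section \<open>Discretization of cadlag paths\<close>

text \<open>The inverse time change is admissible, and the horizon shrinks by the displacement \<open>e\<close>.\<close>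

lemma skorohod_nbhd_sym:
  assumes x: "x \<in> cadlag_paths S" and e: "0 < e" and y: "y \<in> skorohod_nbhd S x (T + e) e"
  shows "x \<in> skorohod_nbhd S y T e"
proof (cases "0 \<le> T")
  case False
  then show ?thesis using x id_time_change unfolding skorohod_nbhd_def by auto
next
  case T: True
  obtain l where l: "l \<in> time_changes"
    and c: "\<And>s. s \<in> {0..T + e} \<Longrightarrow> \<bar>l s - s\<bar> < e \<and> dist (y (l s)) (x s) < e"
    using y unfolding skorohod_nbhd_def by blast
  have mono: "l r < l s" if "0 \<le> r" "r < s" for r s
    using l that unfolding time_changes_def strict_mono_on_def by auto
  have img: "l ` {0..} = {0..}" using l unfolding time_changes_def by auto
  define m where "m = inv_into {0..} l"
  have m0: "0 \<le> m s" and lm: "l (m s) = s" if "0 \<le> s" for s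
  proof -
    have "s \<in> l ` {0..}" using img that by simp
    then show "0 \<le> m s" "l (m s) = s"
      unfolding m_def using inv_into_into[of s l "{0..}"] f_inv_into_f[of s l "{0..}"] by auto
  qed
  have ml: "m (l s) = s" if "0 \<le> s" for s
  proof -
    have "0 \<le> l s" using img that by auto
    then have "l (m (l s)) = l s" "0 \<le> m (l s)" using lm m0 by auto
    then show ?thesis using mono[of s "m (l s)"] mono[of "m (l s)" s] that by (metis less_irrefl linorder_neqE)
  qed
  have "m \<in> time_changes"
    unfolding time_changes_def
  proof (intro CollectI conjI)
    show "strict_mono_on {0..} m"
    proof (rule strict_mono_onI)
      fix r s :: real assume rs: "r \<in> {0..}" "s \<in> {0..}" "r < s"
      show "m r < m s"
      proof (rule ccontr)
        assume "\<not> m r < m s"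
        then have "m s = m r \<or> m s < m r" by auto
        then have "l (m s) \<le> l (m r)" using mono[of "m s" "m r"] m0[of s] rs by auto
        then show False using lm rs by auto
      qed
    qed
    show "m ` {0..} = {0..}"
    proof (intro equalityI subsetI)
      fix s :: real assume "s \<in> {0..}"
      then have "s = m (l s)" "l s \<in> {0..}" using ml img by auto
      then show "s \<in> m ` {0..}" by blast
    qed (use m0 in auto)
  qed
  moreover have "\<bar>m s - s\<bar> < e \<and> dist (x (m s)) (y s) < e" if s: "s \<in> {0..T}" for s
  proof -
    have "m s < T + e"
    proof (rule ccontr)
      assume *: "\<not> m s < T + e"
      then have "l (T + e) \<le> l (m s)" using mono[of "T + e" "m s"] T e by (cases "m s = T + e") auto
      moreover have "T < l (T + e)" using c[of "T + e"] T e by auto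
      ultimately show False using lm[of s] s by auto
    qed
    then show ?thesis using c[of "m s"] m0[of s] lm[of s] s by (auto simp: dist_commute)
  qed
  ultimately show ?thesis using x unfolding skorohod_nbhd_def by blast
qed

text \<open>A point of a cell is displaced by a convex combination of the displacements of the two end points;
  this is why the bound \<open>d\<close> at the nodes holds everywhere.\<close>

lemma piecewise_linear_time_change:
  fixes u t :: "nat \<Rightarrow> real"
  assumes u: "strict_mono u" "u 0 = 0" "\<And>B. \<exists>i. B < u i"
    and t: "strict_mono t" "t 0 = 0" "\<And>B. \<exists>i. B < t i"
    and close: "\<And>i. \<bar>u i - t i\<bar> \<le> d"
  obtains l where "l \<in> time_changes"
    "\<And>i s. u i \<le> s \<Longrightarrow> s < u (Suc i) \<Longrightarrow> t i \<le> l s \<and> l s < t (Suc i)"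
    "\<And>s. 0 \<le> s \<Longrightarrow> \<bar>l s - s\<bar> \<le> d"
proof -
  have cell: "\<exists>i. v i \<le> s \<and> s < v (Suc i)"
    if v: "strict_mono v" "v 0 = 0" "\<And>B. \<exists>i. B < v i" and s: "0 \<le> s" for v :: "nat \<Rightarrow> real" and s
  proof -
    define j where "j = (LEAST j. s < v j)"
    have j: "s < v j" unfolding j_def using v(3) by (rule LeastI_ex)
    then obtain i where i: "j = Suc i" using v(2) s by (cases j) auto
    have "\<not> s < v i" using not_less_Least[of i "\<lambda>j. s < v j"] i unfolding j_def by simp
    then show ?thesis using j i by (intro exI[of _ i]) auto
  qed
  have cell_unique: "i = j" if "strict_mono v" "v i \<le> s" "s < v (Suc i)" "v j \<le> s" "s < v (Suc j)"
    for v :: "nat \<Rightarrow> real" and s i j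
  proof (rule ccontr)
    assume "i \<noteq> j"
    then have "Suc i \<le> j \<or> Suc j \<le> i" by auto
    then have "v (Suc i) \<le> v j \<or> v (Suc j) \<le> v i"
      using that(1) by (auto simp: strict_mono_less_eq)
    then show False using that by auto
  qed
  define idx where "idx s = (THE i. u i \<le> s \<and> s < u (Suc i))" for s
  have idx: "idx s = i" if "u i \<le> s" "s < u (Suc i)" for i s
    unfolding idx_def using that cell_unique[OF u(1)] by (intro the_equality) auto
  define l where "l s = t (idx s) + (s - u (idx s)) / (u (Suc (idx s)) - u (idx s)) * (t (Suc (idx s)) - t (idx s))" for s
  have pos: "0 < u (Suc i) - u i" "0 < t (Suc i) - t i" for i
    using u(1) t(1) by (auto simp: strict_mono_less)
  have l: "l s = t i + (s - u i) / (u (Suc i) - u i) * (t (Suc i) - t i)"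
    if "u i \<le> s" "s < u (Suc i)" for i s
    unfolding l_def idx[OF that] ..
  have range: "t i \<le> l s \<and> l s < t (Suc i)" if "u i \<le> s" "s < u (Suc i)" for i s
  proof -
    define w where "w = (s - u i) / (u (Suc i) - u i)"
    have w: "0 \<le> w" "w < 1" unfolding w_def using that pos[of i] by (auto simp: divide_simps)
    have "0 \<le> w * (t (Suc i) - t i)" "w * (t (Suc i) - t i) < 1 * (t (Suc i) - t i)"
      using w pos(2)[of i] by (auto intro!: mult_strict_right_mono)
    then show ?thesis unfolding l[OF that] w_def[symmetric] by auto
  qed
  have close_id: "\<bar>l s - s\<bar> \<le> d" if s: "0 \<le> s" for s
  proof -
    obtain i where i: "u i \<le> s" "s < u (Suc i)" using cell[OF u s] by blast
    define w where "w = (s - u i) / (u (Suc i) - u i)"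
    have w: "0 \<le> w" "w < 1" unfolding w_def using i pos[of i] by (auto simp: divide_simps)
    have "s = u i + w * (u (Suc i) - u i)" unfolding w_def using pos[of i] by auto
    then have "l s - s = (1 - w) * (t i - u i) + w * (t (Suc i) - u (Suc i))"
      unfolding l[OF i] w_def[symmetric] by (simp add: algebra_simps)
    also have "\<bar>\<dots>\<bar> \<le> (1 - w) * d + w * d"
    proof -
      have "\<bar>(1 - w) * (t i - u i)\<bar> \<le> (1 - w) * d" "\<bar>w * (t (Suc i) - u (Suc i))\<bar> \<le> w * d"
        using w close[of i] close[of "Suc i"] by (auto simp: abs_mult abs_minus_commute intro!: mult_left_mono)
      then show ?thesis by linarith
    qed
    finally show ?thesis by (simp add: algebra_simps)
  qed
  have "l \<in> time_changes"
    unfolding time_changes_def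
  proof (intro CollectI conjI)
    show "strict_mono_on {0..} l"
    proof (rule strict_mono_onI)
      fix r s :: real assume rs: "r \<in> {0..}" "s \<in> {0..}" "r < s"
      obtain i where i: "u i \<le> r" "r < u (Suc i)" using cell[OF u, of r] rs by auto
      obtain j where j: "u j \<le> s" "s < u (Suc j)" using cell[OF u, of s] rs by auto
      have "u i < u (Suc j)" using i j rs by auto
      then have "i \<le> j" using u(1) by (auto simp: strict_mono_less)
      show "l r < l s"
      proof (cases "i = j")
        case True
        have "(r - u i) / (u (Suc i) - u i) < (s - u i) / (u (Suc i) - u i)"
          using rs pos(1)[of i] by (intro divide_strict_right_mono) auto
        then have "(r - u i) / (u (Suc i) - u i) * (t (Suc i) - t i) < (s - u i) / (u (Suc i) - u i) * (t (Suc i) - t i)"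
          using pos(2)[of i] by (intro mult_strict_right_mono) auto
        then show ?thesis using l[OF i] l[of i s] j True by auto
      next
        case False
        then have "t (Suc i) \<le> t j" using \<open>i \<le> j\<close> t(1) by (auto simp: strict_mono_less_eq)
        then show ?thesis using range[OF i] range[OF j] by auto
      qed
    qed
    show "l ` {0..} = {0..}"
    proof (intro equalityI subsetI)
      fix z assume "z \<in> l ` {0..}"
      then obtain s where s: "z = l s" "0 \<le> s" by auto
      obtain i where i: "u i \<le> s" "s < u (Suc i)" using cell[OF u s(2)] by blast
      have "t 0 \<le> t i" using t(1) by (simp add: strict_mono_less_eq)
      then show "z \<in> {0..}" using range[OF i] s t(2) by auto
    next
      fix z :: real assume "z \<in> {0..}"
      then obtain i where i: "t i \<le> z" "z < t (Suc i)" using cell[OF t, of z] by auto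
      define w where "w = (z - t i) / (t (Suc i) - t i)"
      have w: "0 \<le> w" "w < 1" unfolding w_def using i pos[of i] by (auto simp: divide_simps)
      define s where "s = u i + w * (u (Suc i) - u i)"
      have "0 \<le> w * (u (Suc i) - u i)" "w * (u (Suc i) - u i) < 1 * (u (Suc i) - u i)"
        using w pos(1)[of i] by (auto intro!: mult_strict_right_mono)
      then have s: "u i \<le> s" "s < u (Suc i)" unfolding s_def by auto
      have "(s - u i) / (u (Suc i) - u i) = w" unfolding s_def using pos(1)[of i] by auto
      then have "l s = z" unfolding l[OF s] w_def using pos(2)[of i] by auto
      moreover have "0 \<le> s" using s(1) u(1,2) strict_mono_less_eq[OF u(1), of 0 i] by auto
      ultimately show "z \<in> l ` {0..}" by auto
    qed
  qed
  then show thesis using range close_id by (rule that)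
qed

text \<open>The index is capped at \<open>k * k\<close>, so the path is frozen from time \<open>k\<close> on and depends on finitely many
  values; that makes it a function of a finite-dimensional marginal.\<close>

definition grid_path :: "nat \<Rightarrow> (nat \<Rightarrow> 'b) \<Rightarrow> real \<Rightarrow> 'b" where
  "grid_path k v = (\<lambda>t\<in>{0..}. v (min (nat \<lfloor>real k * t\<rfloor>) (k * k)))"

definition discretize :: "nat \<Rightarrow> (real \<Rightarrow> 'b) \<Rightarrow> real \<Rightarrow> 'b" where
  "discretize k x = grid_path k (\<lambda>i. x (real i / real k))"

lemma grid_path_cadlag:
  fixes v :: "nat \<Rightarrow> 'b::topological_space"
  assumes k: "0 < k" and v: "\<And>i. i \<le> k * k \<Longrightarrow> v i \<in> S"
  shows "grid_path k v \<in> cadlag_paths S"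
  unfolding cadlag_paths_def
proof (intro CollectI conjI allI impI)
  show "grid_path k v \<in> {0..} \<rightarrow>\<^sub>E S" unfolding grid_path_def using v by auto
  fix t :: real assume t: "0 \<le> t"
  have "t < (of_int \<lfloor>real k * t\<rfloor> + 1) / real k"
    using k by (simp add: pos_less_divide_eq mult.commute[of t])
  from eventually_at_right_real[OF this]
  have "\<forall>\<^sub>F s in at_right t. grid_path k v s = grid_path k v t"
  proof eventually_elim
    case (elim s)
    have "real k * s < of_int \<lfloor>real k * t\<rfloor> + 1"
      using elim k by (simp add: pos_less_divide_eq mult.commute[of s])
    moreover have "real k * t \<le> real k * s" using elim k by simp
    then have "of_int \<lfloor>real k * t\<rfloor> \<le> real k * s" by linarith
    ultimately have "\<lfloor>real k * s\<rfloor> = \<lfloor>real k * t\<rfloor>" by (simp add: floor_eq_iff)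
    then show ?case using t elim unfolding grid_path_def by auto
  qed
  then show "(grid_path k v \<longlongrightarrow> grid_path k v t) (at_right t)"
    by (rule tendsto_eventually)
  assume t: "0 < t"
  define c where "c = v (min (nat (\<lceil>real k * t\<rceil> - 1)) (k * k))"
  have "max 0 ((of_int \<lceil>real k * t\<rceil> - 1) / real k) < t"
    using k t by (simp add: pos_divide_less_eq mult.commute[of t]) linarith
  from eventually_at_left_real[OF this]
  have "\<forall>\<^sub>F s in at_left t. grid_path k v s = c"
  proof eventually_elim
    case (elim s)
    have "of_int \<lceil>real k * t\<rceil> - 1 < real k * s"
      using elim k by (simp add: pos_divide_less_eq mult.commute[of s])
    moreover have "real k * s < real k * t" using elim k by simp
    then have "real k * s < of_int \<lceil>real k * t\<rceil>" by linarith
    ultimately have "\<lfloor>real k * s\<rfloor> = \<lceil>real k * t\<rceil> - 1" by (simp add: floor_eq_iff)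
    then show ?case using elim unfolding grid_path_def c_def by auto
  qed
  then have "(grid_path k v \<longlongrightarrow> c) (at_left t)" by (rule tendsto_eventually)
  then show "\<exists>l\<in>S. (grid_path k v \<longlongrightarrow> l) (at_left t)"
    using v unfolding c_def by auto
qed

lemma discretize_cadlag:
  fixes x :: "real \<Rightarrow> 'b::topological_space"
  assumes "0 < k" "x \<in> cadlag_paths S"
  shows "discretize k x \<in> cadlag_paths S"
  unfolding discretize_def using assms
  by (intro grid_path_cadlag) (auto simp: cadlag_paths_def PiE_def Pi_def)

text \<open>Sampling on the grid of mesh \<open>1 / k\<close> delays the \<open>i\<close>-th partition point \<open>t i\<close> to the next grid point
  \<open>\<lceil>k * t i\<rceil> / k\<close>. Points at distance at least \<open>1 / k\<close> are delayed to distinct grid points, so the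
  piecewise linear map undoing the delay is a time change, and it carries each cell of the sampled path
  into the matching cell of the original one, where the oscillation is below \<open>e\<close>.\<close>

lemma discretize_nbhd_of_partition:
  fixes y :: "real \<Rightarrow> 'b::metric_space"
  assumes y: "y \<in> cadlag_paths S" and k: "0 < k" "1 / real k < e" "T \<le> real k"
    and t: "t 0 = 0" "\<And>i. i < r \<Longrightarrow> t i + 1 / real k \<le> t (Suc i)" "T + 1 < t r"
    and osc: "\<And>i a b. i < r \<Longrightarrow> a \<in> {t i..<t (Suc i)} \<Longrightarrow> b \<in> {t i..<t (Suc i)} \<Longrightarrow> dist (y a) (y b) < e"
  shows "y \<in> skorohod_nbhd S (discretize k y) T e"
proof -
  (* Beyond the given cells the partition continues with unit steps, so as to exhaust the half-line. *)
  define t' where "t' i = (if i \<le> r then t i else t r + real (i - r))" for i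
  have kinv: "0 < 1 / real k" "1 / real k \<le> 1" using k(1) by auto
  have step: "t' i + 1 / real k \<le> t' (Suc i)" for i
  proof (cases "i < r")
    case True
    then show ?thesis using t(2) unfolding t'_def by auto
  next
    case False
    then have "t' (Suc i) = t r + (real (i - r) + 1)" unfolding t'_def by (simp add: Suc_diff_le)
    moreover have "t' i = t r + real (i - r)" unfolding t'_def using False by auto
    ultimately show ?thesis using kinv by auto
  qed
  have t'0: "t' 0 = 0" unfolding t'_def using t by simp
  have t'lower: "real i / real k \<le> t' i" for i
  proof (induction i)
    case (Suc i)
    have "real (Suc i) / real k = real i / real k + 1 / real k" by (simp add: add_divide_distrib)
    then show ?case using Suc step[of i] by linarith
  qed (simp add: t'0)
  have mono: "strict_mono t'"
  proof (rule strict_monoI_Suc)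
    show "t' i < t' (Suc i)" for i using step[of i] kinv by linarith
  qed
  have unb: "\<exists>i. B < t' i" for B
  proof -
    obtain i where "B * real k < real i" using reals_Archimedean2 by blast
    then have "B < real i / real k" using k(1) by (simp add: pos_less_divide_eq)
    then show ?thesis using t'lower[of i] by (intro exI[of _ i]) linarith
  qed
  (* The first grid points at or after the partition points. *)
  define u where "u i = of_int \<lceil>real k * t' i\<rceil> / real k" for i
  have u_ge: "t' i \<le> u i" and u_le: "u i \<le> t' i + 1 / real k" for i
  proof -
    show "t' i \<le> u i" unfolding u_def using k(1) by (simp add: pos_le_divide_eq mult.commute[of "t' i"])
    have "of_int \<lceil>real k * t' i\<rceil> \<le> real k * t' i + 1" by linarith
    then have "u i \<le> (real k * t' i + 1) / real k" unfolding u_def by (intro divide_right_mono) auto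
    also have "\<dots> = t' i + 1 / real k" using k(1) by (simp add: add_divide_distrib)
    finally show "u i \<le> t' i + 1 / real k" .
  qed
  have u_mono: "strict_mono u"
  proof (rule strict_monoI_Suc)
    fix i
    have "real k * (t' i + 1 / real k) \<le> real k * t' (Suc i)" using step[of i] by (intro mult_left_mono) auto
    then have "real k * t' i + 1 \<le> real k * t' (Suc i)" using k(1) by (simp add: distrib_left)
    then have "\<lceil>real k * t' i\<rceil> < \<lceil>real k * t' (Suc i)\<rceil>" by linarith
    then show "u i < u (Suc i)" unfolding u_def using k(1) by (intro divide_strict_right_mono) auto
  qed
  have u0: "u 0 = 0" unfolding u_def t'0 by simp
  have u_unb: "\<exists>i. B < u i" for B using unb[of B] u_ge by (meson less_le_trans)
  have close: "\<bar>u i - t' i\<bar> \<le> 1 / real k" for i using u_ge[of i] u_le[of i] by linarith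
  obtain l where l: "l \<in> time_changes"
    and cell: "\<And>i s. u i \<le> s \<Longrightarrow> s < u (Suc i) \<Longrightarrow> t' i \<le> l s \<and> l s < t' (Suc i)"
    and lid: "\<And>s. 0 \<le> s \<Longrightarrow> \<bar>l s - s\<bar> \<le> 1 / real k"
    using piecewise_linear_time_change[OF u_mono u0 u_unb mono t'0 unb close] by blast
  have "\<bar>l s - s\<bar> < e \<and> dist (y (l s)) (discretize k y s) < e" if s: "s \<in> {0..T}" for s
  proof
    show "\<bar>l s - s\<bar> < e" using lid[of s] s k(2) by auto
    define j where "j = (LEAST j. s < u j)"
    have j: "s < u j" unfolding j_def using u_unb by (rule LeastI_ex)
    then obtain i where i: "j = Suc i" using s u0 by (cases j) auto
    have "\<not> s < u i" using not_less_Least[of i "\<lambda>j. s < u j"] i unfolding j_def by simp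
    then have i: "u i \<le> s" "s < u (Suc i)" using j i by auto
    have ls: "t' i \<le> l s" "l s < t' (Suc i)" using cell[OF i] by auto
    have "0 \<le> s" "s \<le> T" using s by auto
    then have "l s \<le> T + 1" using lid[of s] kinv by linarith
    have "i < r"
    proof (rule ccontr)
      assume "\<not> i < r"
      then have "t' r \<le> t' i" using mono by (simp add: strict_mono_less_eq)
      then show False using ls \<open>l s \<le> T + 1\<close> t(3) unfolding t'_def by auto
    qed
    (* The grid time at which the sampled path reads y; it lies in the same cell as l s. *)
    define c where "c = of_int \<lfloor>real k * s\<rfloor> / real k"
    have "real k * s \<le> real k * real k" using s k by (intro mult_left_mono) auto
    then have "\<lfloor>real k * s\<rfloor> \<le> int (k * k)" by (simp add: floor_le_iff)
    then have "nat \<lfloor>real k * s\<rfloor> \<le> k * k" by linarith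
    then have disc: "discretize k y s = y c"
      unfolding discretize_def grid_path_def c_def using s by (simp add: min_absorb1)
    have "of_int \<lceil>real k * t' i\<rceil> \<le> real k * s"
      using i(1) k(1) unfolding u_def by (simp add: pos_divide_le_eq mult.commute[of s])
    then have "\<lceil>real k * t' i\<rceil> \<le> \<lfloor>real k * s\<rfloor>" by (simp add: le_floor_iff)
    then have "real k * t' i \<le> of_int \<lfloor>real k * s\<rfloor>" by (simp add: ceiling_le_iff)
    then have c1: "t' i \<le> c" unfolding c_def using k(1) by (simp add: pos_le_divide_eq mult.commute[of "t' i"])
    have "real k * s < of_int \<lceil>real k * t' (Suc i)\<rceil>"
      using i(2) k(1) unfolding u_def by (simp add: pos_less_divide_eq mult.commute[of s])
    then have "\<lfloor>real k * s\<rfloor> < \<lceil>real k * t' (Suc i)\<rceil>" by (simp add: floor_less_iff)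
    then have "of_int \<lfloor>real k * s\<rfloor> < real k * t' (Suc i)" by (simp add: less_ceiling_iff)
    then have c2: "c < t' (Suc i)" unfolding c_def using k(1) by (simp add: pos_divide_less_eq mult.commute[of "t' (Suc i)"])
    have "t' i = t i" "t' (Suc i) = t (Suc i)" using \<open>i < r\<close> unfolding t'_def by auto
    then show "dist (y (l s)) (discretize k y s) < e"
      unfolding disc using osc[OF \<open>i < r\<close>, of "l s" c] ls c1 c2 by auto
  qed
  then show ?thesis using y l unfolding skorohod_nbhd_def by blast
qed

text \<open>One-sided limits give a good cell on each side of every point, and bisection joins these
  local partitions. The reflexive transitive closure of ``is a good cell'' expresses ``has a
  finite partition into good cells'' and makes concatenation transitivity.\<close>

lemma cadlag_partition:
  fixes y :: "real \<Rightarrow> 'b::metric_space"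
  assumes y: "y \<in> cadlag_paths S" and e: "0 < e" and T: "0 \<le> T"
  defines "R \<equiv> \<lambda>a b. a < b \<and> (\<forall>s\<in>{a..<b}. \<forall>s'\<in>{a..<b}. dist (y s) (y s') < e)"
  shows "R\<^sup>*\<^sup>* 0 T"
proof -
  have "(0::real) \<le> 0 \<longrightarrow> 0 \<le> T \<longrightarrow> R\<^sup>*\<^sup>* 0 T"
    using T
  proof (induction rule: Bolzano[where P = "\<lambda>a b. 0 \<le> a \<longrightarrow> a \<le> b \<longrightarrow> R\<^sup>*\<^sup>* a b"])
    case (trans a b c)
    then show ?case by (meson order_trans rtranclp_trans)
  next
    case (local x)
    have "(y \<longlongrightarrow> y x) (at_right x)" using y local unfolding cadlag_paths_def by auto
    then have "\<forall>\<^sub>F s in at_right x. dist (y s) (y x) < e / 2" using e by (intro tendstoD) auto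
    then obtain b1 where b1: "x < b1" "\<And>s. x < s \<Longrightarrow> s < b1 \<Longrightarrow> dist (y s) (y x) < e / 2"
      unfolding eventually_at_right_field by blast
    have "\<exists>a1<x. 0 < x \<longrightarrow> (\<exists>c. \<forall>s. a1 < s \<longrightarrow> s < x \<longrightarrow> dist (y s) c < e / 2)"
    proof (cases "0 < x")
      case True
      then have "\<exists>l\<in>S. (y \<longlongrightarrow> l) (at_left x)" using y by (simp add: cadlag_paths_def)
      then obtain c where "(y \<longlongrightarrow> c) (at_left x)" by blast
      then have "\<forall>\<^sub>F s in at_left x. dist (y s) c < e / 2" using e by (intro tendstoD) auto
      then show ?thesis unfolding eventually_at_left_field by blast
    qed (auto intro!: exI[of _ "x - 1"])
    then obtain a1 c where a1: "a1 < x" "\<And>s. 0 < x \<Longrightarrow> a1 < s \<Longrightarrow> s < x \<Longrightarrow> dist (y s) c < e / 2"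
      by blast
    show ?case
    proof (intro exI[of _ "min (b1 - x) (x - a1)"] conjI allI impI)
      show "0 < min (b1 - x) (x - a1)" using a1 b1 by auto
      fix a b assume ab: "a \<le> x \<and> x \<le> b \<and> b - a < min (b1 - x) (x - a1)" "0 \<le> a" "a \<le> b"
      have tri: "dist (y s) (y s') < e" if "dist (y s) z < e / 2" "dist (y s') z < e / 2" for s s' z
        using that by (rule dist_triangle_half_l)
      have R1: "R a x" if "a < x"
      proof -
        have "dist (y s) c < e / 2" if "s \<in> {a..<x}" for s
          using a1(2)[of s] that ab \<open>a < x\<close> by auto
        then show ?thesis unfolding R_def using tri that by blast
      qed
      have R2: "R x b" if "x < b"
      proof -
        have "dist (y s) (y x) < e / 2" if "s \<in> {x..<b}" for s
          using b1(2)[of s] that ab e by (cases "s = x") auto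
        then show ?thesis unfolding R_def using tri that by blast
      qed
      have "R\<^sup>*\<^sup>* a x" using R1 ab by (cases "a < x") auto
      moreover have "R\<^sup>*\<^sup>* x b" using R2 ab by (cases "x < b") auto
      ultimately show "R\<^sup>*\<^sup>* a b" by (rule rtranclp_trans)
    qed
  qed
  then show ?thesis using T by simp
qed

lemma discretize_eventually_nbhd:
  fixes y :: "real \<Rightarrow> 'b::metric_space"
  assumes y: "y \<in> cadlag_paths S" and e: "0 < e"
  shows "\<forall>\<^sub>F k in sequentially. y \<in> skorohod_nbhd S (discretize k y) T e"
proof -
  define R where "R a b \<longleftrightarrow> a < b \<and> (\<forall>s\<in>{a..<b}. \<forall>s'\<in>{a..<b}. dist (y s) (y s') < e)" for a b
  have "R\<^sup>*\<^sup>* 0 (max T 0 + 2)"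
    unfolding R_def using cadlag_partition[OF y e, of "max T 0 + 2"] by simp
  then obtain r where "(R ^^ r) 0 (max T 0 + 2)" by (auto simp: rtranclp_power)
  then obtain t where t: "t 0 = 0" "t r = max T 0 + 2" "\<And>i. i < r \<Longrightarrow> R (t i) (t (Suc i))"
    unfolding relpowp_fun_conv by blast
  have "\<forall>\<^sub>F k in sequentially. 1 / real k < c" if "0 < c" for c
    using that lim_1_over_n[where 'a=real] by (auto dest: order_tendstoD(2))
  note small = this
  have "\<forall>\<^sub>F k in sequentially. \<forall>i\<in>{..<r}. 1 / real k < t (Suc i) - t i"
  proof (rule eventually_ball_finite)
    show "\<forall>i\<in>{..<r}. \<forall>\<^sub>F k in sequentially. 1 / real k < t (Suc i) - t i"
      using t(3) small unfolding R_def by auto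
  qed auto
  moreover have "\<forall>\<^sub>F k in sequentially. T \<le> real k"
    using eventually_ge_at_top[of "nat \<lceil>T\<rceil>"] by eventually_elim linarith
  ultimately show ?thesis
    using small[OF e] eventually_gt_at_top[of 0]
  proof eventually_elim
    case (elim k)
    show ?case
    proof (rule discretize_nbhd_of_partition[where t = t and r = r])
      show "t i + 1 / real k \<le> t (Suc i)" if "i < r" for i using elim(1) that by force
      show "dist (y a) (y b) < e" if "i < r" "a \<in> {t i..<t (Suc i)}" "b \<in> {t i..<t (Suc i)}" for i a b
        using t(3)[OF that(1)] that unfolding R_def by blast
    qed (use elim y t in auto)
  qed
qed

section \<open>Uniformly continuous functionals of cadlag paths\<close>

text \<open>Uniform continuity for the uniformity whose entourages are the sets
  \<^const>\<open>skorohod_nbhd\<close>. It compares a path with its discretization by a bound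
  that is the same for all paths.\<close>

definition skorohod_ucont :: "'b::metric_space set \<Rightarrow> ((real \<Rightarrow> 'b) \<Rightarrow> real) \<Rightarrow> bool" where
  "skorohod_ucont S h \<longleftrightarrow>
     (\<forall>e>0. \<exists>T. \<exists>d>0. \<forall>x\<in>cadlag_paths S. \<forall>y\<in>skorohod_nbhd S x T d. \<bar>h x - h y\<bar> < e)"

definition skorohod_lsc :: "'b::metric_space set \<Rightarrow> ((real \<Rightarrow> 'b) \<Rightarrow> real) \<Rightarrow> bool" where
  "skorohod_lsc S f \<longleftrightarrow>
     (\<forall>x\<in>cadlag_paths S. \<forall>c<f x. \<exists>T. \<exists>d>0. \<forall>y\<in>skorohod_nbhd S x T d. c < f y)"

text \<open>A quasi-metric: horizon and precision are tied as \<open>1 / e\<close> and \<open>e\<close>, which is what makes the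
  triangle inequality below work although composing time changes costs some horizon.\<close>

definition skorohod_gap :: "'b::metric_space set \<Rightarrow> (real \<Rightarrow> 'b) \<Rightarrow> (real \<Rightarrow> 'b) \<Rightarrow> real" where
  "skorohod_gap S x z = Inf ({e. 0 < e \<and> e \<le> 1 \<and> z \<in> skorohod_nbhd S x (1 / e) e} \<union> {1})"

lemma skorohod_gap_bdd: "bdd_below ({e::real. 0 < e \<and> e \<le> 1 \<and> P e} \<union> {1})"
  by (rule bdd_belowI[of _ 0]) auto

lemma skorohod_gap_nonneg: "0 \<le> skorohod_gap S x z"
  unfolding skorohod_gap_def by (rule cInf_greatest) auto

lemma skorohod_gap_le_1: "skorohod_gap S x z \<le> 1"
  unfolding skorohod_gap_def by (rule cInf_lower[OF _ skorohod_gap_bdd]) auto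

lemma skorohod_gap_le:
  assumes "0 < e" "z \<in> skorohod_nbhd S x (1 / e) e"
  shows "skorohod_gap S x z \<le> e"
proof (cases "e \<le> 1")
  case True
  then show ?thesis using assms unfolding skorohod_gap_def
    by (intro cInf_lower[OF _ skorohod_gap_bdd]) auto
next
  case False
  then show ?thesis using skorohod_gap_le_1[of S x z] by simp
qed

lemma skorohod_gap_lessD:
  assumes "skorohod_gap S x z < e" "e \<le> 1"
  shows "z \<in> skorohod_nbhd S x (1 / e) e"
proof -
  obtain a where a: "a \<in> {e. 0 < e \<and> e \<le> 1 \<and> z \<in> skorohod_nbhd S x (1 / e) e} \<union> {1}" "a < e"
    using assms(1) unfolding skorohod_gap_def by (subst (asm) cInf_less_iff[OF _ skorohod_gap_bdd]) auto
  then have "0 < a" "z \<in> skorohod_nbhd S x (1 / a) a" using assms(2) by auto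
  then show ?thesis using skorohod_nbhd_mono[of "1 / e" "1 / a" a e S x] a(2) by (auto simp: frac_le)
qed

lemma skorohod_gap_refl:
  assumes "x \<in> cadlag_paths S"
  shows "skorohod_gap S x x = 0"
proof (rule antisym[OF _ skorohod_gap_nonneg])
  show "skorohod_gap S x x \<le> 0"
    by (rule field_le_epsilon) (use assms in \<open>auto intro!: skorohod_gap_le skorohod_nbhd_centre\<close>)
qed

text \<open>The triangle property of the neighbourhoods needs the horizon \<open>1 / (d + d') + d\<close> for the second
  pair, and this is at most \<open>1 / d'\<close> because \<open>d' * (d + d') \<le> 1\<close>.\<close>

lemma skorohod_gap_triangle: "skorohod_gap S x z \<le> skorohod_gap S x y + skorohod_gap S y z"
proof (rule field_le_epsilon)
  fix r :: real assume r: "0 < r"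
  define d where "d = skorohod_gap S x y + r / 2"
  define d' where "d' = skorohod_gap S y z + r / 2"
  have d: "0 < d" "0 < d'" "skorohod_gap S x y < d" "skorohod_gap S y z < d'"
    unfolding d_def d'_def using r skorohod_gap_nonneg[of S x y] skorohod_gap_nonneg[of S y z] by auto
  have "skorohod_gap S x z \<le> d + d'"
  proof (cases "d + d' \<le> 1")
    case True
    have "y \<in> skorohod_nbhd S x (1 / d) d" using d True by (intro skorohod_gap_lessD) auto
    moreover have "skorohod_nbhd S x (1 / d) d \<subseteq> skorohod_nbhd S x (1 / (d + d')) d"
      using d by (intro skorohod_nbhd_mono) (auto simp: frac_le)
    ultimately have y: "y \<in> skorohod_nbhd S x (1 / (d + d')) d" by blast
    have z: "z \<in> skorohod_nbhd S y (1 / d') d'" using d True by (intro skorohod_gap_lessD) auto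
    have "d' * (d + d') \<le> 1 * 1" using d True by (intro mult_mono) auto
    then have "d * (d' * (d + d')) \<le> d" using mult_left_mono[of "d' * (d + d')" 1 d] d by auto
    then have "1 / (d + d') + d \<le> 1 / d'"
      using d by (simp add: field_simps)
    then have "z \<in> skorohod_nbhd S y (1 / (d + d') + d) d'"
      using z skorohod_nbhd_mono[of "1 / (d + d') + d" "1 / d'" d' d' S y] by auto
    from skorohod_nbhd_triangle[OF y this] show ?thesis
      using d by (intro skorohod_gap_le) auto
  next
    case False
    then show ?thesis using skorohod_gap_le_1[of S x z] by auto
  qed
  then show "skorohod_gap S x z \<le> skorohod_gap S x y + skorohod_gap S y z + r"
    unfolding d_def d'_def by auto
qed

text \<open>The Lipschitz regularizations \<open>u m x = INF z. f z + m * gap x z\<close>. They are Lipschitz for the gap by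
  its triangle inequality, and at \<open>x\<close> only points close to \<open>x\<close> can compete in the infimum when \<open>m\<close> is
  large, so lower semicontinuity gives the convergence.\<close>

lemma skorohod_lsc_approx:
  fixes f :: "(real \<Rightarrow> 'b::metric_space) \<Rightarrow> real"
  assumes lsc: "skorohod_lsc S f" and B: "\<And>x. x \<in> cadlag_paths S \<Longrightarrow> - B \<le> f x"
  obtains u :: "nat \<Rightarrow> (real \<Rightarrow> 'b) \<Rightarrow> real" where
    "\<And>m. skorohod_ucont S (u m)"
    "\<And>m x. x \<in> cadlag_paths S \<Longrightarrow> - B \<le> u m x \<and> u m x \<le> f x"
    "\<And>x. x \<in> cadlag_paths S \<Longrightarrow> (\<lambda>m. u m x) \<longlonglongrightarrow> f x"
proof -
  define u where "u m x = (INF z\<in>cadlag_paths S. f z + real m * skorohod_gap S x z)" for m x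
  have bdd: "bdd_below ((\<lambda>z. f z + real m * skorohod_gap S x z) ` cadlag_paths S)" for m x
    using B skorohod_gap_nonneg[of S x] by (intro bdd_belowI2[of _ "- B"]) (smt (verit) mult_nonneg_nonneg of_nat_0_le_iff)
  have upper: "u m x \<le> f x" if "x \<in> cadlag_paths S" for m x
    using cINF_lower[OF bdd that, of m x] that unfolding u_def by (simp add: skorohod_gap_refl)
  have lower: "c \<le> u m x" if "x \<in> cadlag_paths S"
    "\<And>z. z \<in> cadlag_paths S \<Longrightarrow> c \<le> f z + real m * skorohod_gap S x z" for c m x
    unfolding u_def using that by (intro cINF_greatest) auto
  have lip: "u m x \<le> u m y + real m * skorohod_gap S x y"
    if "x \<in> cadlag_paths S" "y \<in> cadlag_paths S" for m x y
  proof -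
    have "u m x - real m * skorohod_gap S x y \<le> u m y"
    proof (rule lower[OF that(2)])
      fix z assume z: "z \<in> cadlag_paths S"
      have "u m x \<le> f z + real m * skorohod_gap S x z"
        unfolding u_def by (rule cINF_lower[OF bdd z])
      also have "\<dots> \<le> f z + real m * (skorohod_gap S x y + skorohod_gap S y z)"
        by (intro add_left_mono mult_left_mono skorohod_gap_triangle) auto
      finally show "u m x - real m * skorohod_gap S x y \<le> f z + real m * skorohod_gap S y z"
        by (simp add: algebra_simps)
    qed
    then show ?thesis by simp
  qed
  have "skorohod_ucont S (u m)" for m
    unfolding skorohod_ucont_def
  proof (intro allI impI)
    fix e :: real assume e: "0 < e"
    define d where "d = e / (2 * (real m + 1))"
    have d: "0 < d" unfolding d_def using e by auto
    have md: "real m * d < e"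
    proof -
      have "real m * d \<le> (real m + 1) * d" using d by (intro mult_right_mono) auto
      also have "\<dots> = e / 2"
      proof -
        have "real m + 1 \<noteq> 0" by linarith
        then show ?thesis unfolding d_def by (simp add: divide_simps)
      qed
      finally show ?thesis using e by linarith
    qed
    (* The extra horizon d pays for exchanging x and y, since the gap is not symmetric. *)
    have "\<bar>u m x - u m y\<bar> < e" if x: "x \<in> cadlag_paths S" and y: "y \<in> skorohod_nbhd S x (1 / d + d) d" for x y
    proof -
      have yc: "y \<in> cadlag_paths S" using y unfolding skorohod_nbhd_def by auto
      have "y \<in> skorohod_nbhd S x (1 / d) d" using y d skorohod_nbhd_mono[of "1 / d" "1 / d + d" d d S x] by auto
      then have "skorohod_gap S x y \<le> d" using d by (intro skorohod_gap_le)
      moreover have "skorohod_gap S y x \<le> d"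
        using d skorohod_nbhd_sym[OF x d y] by (intro skorohod_gap_le)
      ultimately have "real m * skorohod_gap S x y \<le> real m * d" "real m * skorohod_gap S y x \<le> real m * d"
        by (auto intro!: mult_left_mono)
      then show ?thesis using lip[OF x yc, of m] lip[OF yc x, of m] md by linarith
    qed
    then show "\<exists>T. \<exists>d>0. \<forall>x\<in>cadlag_paths S. \<forall>y\<in>skorohod_nbhd S x T d. \<bar>u m x - u m y\<bar> < e"
      using d by blast
  qed
  moreover have "- B \<le> u m x" if "x \<in> cadlag_paths S" for m x
    using that B skorohod_gap_nonneg[of S x] by (intro lower) (smt (verit) mult_nonneg_nonneg of_nat_0_le_iff)+
  moreover have "(\<lambda>m. u m x) \<longlonglongrightarrow> f x" if x: "x \<in> cadlag_paths S" for x
  proof (rule order_tendstoI)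
    fix c assume c: "c < f x"
    define c' where "c' = (c + f x) / 2"
    have c': "c < c'" "c' < f x" unfolding c'_def using c by auto
    then obtain T d where d: "0 < d" "\<And>y. y \<in> skorohod_nbhd S x T d \<Longrightarrow> c' < f y"
      using lsc x unfolding skorohod_lsc_def by blast
    (* The radius r is so small that the r-neighbourhood for the gap lies in the given neighbourhood. *)
    obtain m where m: "T \<le> m" "1 \<le> m" using max.cobounded1 max.cobounded2 by blast
    define r where "r = min (min 1 d) (1 / m)"
    have r: "0 < r" "r \<le> 1" "r \<le> d" "r \<le> 1 / m" unfolding r_def using d m by auto
    then have "m \<le> 1 / r" using m by (simp add: field_simps)
    with m have "T \<le> 1 / r" by linarith
    then have sub: "skorohod_nbhd S x (1 / r) r \<subseteq> skorohod_nbhd S x T d"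
      using r by (intro skorohod_nbhd_mono)
    obtain m0 where m0: "c' + B \<le> real m0 * r"
      using reals_Archimedean3[OF r(1)] by (meson less_imp_le)
    have "c' \<le> u m x" if "m0 \<le> m" for m
    proof (rule lower[OF x])
      fix z assume z: "z \<in> cadlag_paths S"
      show "c' \<le> f z + real m * skorohod_gap S x z"
      proof (cases "skorohod_gap S x z < r")
        case True
        then have "c' < f z" using skorohod_gap_lessD[OF True r(2)] sub d(2) by blast
        then show ?thesis using skorohod_gap_nonneg[of S x z] by (smt (verit) mult_nonneg_nonneg of_nat_0_le_iff)
      next
        case False
        have "real m0 * r \<le> real m * skorohod_gap S x z" using False that r by (intro mult_mono) auto
        then show ?thesis using B[OF z] m0 by linarith
      qed
    qed
    then show "\<forall>\<^sub>F m in sequentially. c < u m x"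
      unfolding eventually_sequentially using c' by (meson less_le_trans)
  next
    fix c assume "f x < c"
    then show "\<forall>\<^sub>F m in sequentially. u m x < c" by (intro always_eventually allI le_less_trans[OF upper[OF x]])
  qed
  ultimately show thesis using upper by (intro that conjI)
qed

lemma skorohod_lsc_continuous_map:
  assumes "continuous_map (skorohod_topology S) euclideanreal f"
  shows "skorohod_lsc S f"
  unfolding skorohod_lsc_def
proof (intro ballI allI impI)
  fix x c assume x: "x \<in> cadlag_paths S" "c < f x"
  have "openin (skorohod_topology S) {y \<in> topspace (skorohod_topology S). f y \<in> {c<..}}"
    using assms by (rule openin_continuous_map_preimage) auto
  then have "\<exists>T>0. \<exists>e>0. skorohod_nbhd S x T e \<subseteq> {y \<in> cadlag_paths S. c < f y}"
    using x unfolding openin_skorohod_topology by auto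
  then show "\<exists>T. \<exists>d>0. \<forall>y\<in>skorohod_nbhd S x T d. c < f y" by blast
qed

lemma skorohod_lsc_indicator:
  assumes "openin (skorohod_topology S) U"
  shows "skorohod_lsc S (indicator U)"
  unfolding skorohod_lsc_def
proof (intro ballI allI impI)
  fix x and c :: real assume x: "x \<in> cadlag_paths S" "c < indicator U x"
  show "\<exists>T. \<exists>d>0. \<forall>y\<in>skorohod_nbhd S x T d. c < indicator U y"
  proof (cases "x \<in> U")
    case True
    then obtain T d where "0 < d" "skorohod_nbhd S x T d \<subseteq> U"
      using assms unfolding openin_skorohod_topology by blast
    then show ?thesis using x True by (intro exI[of _ T] exI[of _ d]) (auto simp: indicator_def)
  next
    case False
    then show ?thesis using x by (intro exI[of _ 0] exI[of _ 1]) (auto simp: indicator_def)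
  qed
qed

lemma skorohod_ucont_discretize_tendsto:
  assumes h: "skorohod_ucont S h" and y: "y \<in> cadlag_paths S"
  shows "(\<lambda>k. h (discretize k y)) \<longlonglongrightarrow> h y"
proof (rule tendstoI)
  fix e :: real assume "0 < e"
  then obtain T d where d: "0 < d"
    "\<And>x y. x \<in> cadlag_paths S \<Longrightarrow> y \<in> skorohod_nbhd S x T d \<Longrightarrow> \<bar>h x - h y\<bar> < e"
    using h unfolding skorohod_ucont_def by blast
  show "\<forall>\<^sub>F k in sequentially. dist (h (discretize k y)) (h y) < e"
    using discretize_eventually_nbhd[OF y d(1), of T] eventually_gt_at_top[of 0]
    by eventually_elim (auto simp: dist_real_def intro!: d(2) discretize_cadlag y)
qed

text \<open>Step paths on a common grid whose values are close are close without any change of time.\<close>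

lemma continuous_map_ucont_grid_path:
  fixes S :: "'b::metric_space set"
  assumes h: "skorohod_ucont S h" and k: "0 < k"
  shows "continuous_map (product_topology (\<lambda>_. top_of_set S) {..<Suc (k * k)}) euclideanreal
           (\<lambda>v. h (grid_path k v))"
proof -
  let ?I = "{..<Suc (k * k)}"
  have "\<exists>U. openin (product_topology (\<lambda>_. top_of_set S) ?I) U \<and> v \<in> U \<and>
      (\<forall>w\<in>U. h (grid_path k w) \<in> Met_TC.mball (h (grid_path k v)) e)"
    if v: "v \<in> topspace (product_topology (\<lambda>_. top_of_set S) ?I)" and e: "0 < e" for v e
  proof -
    have vS: "v \<in> ?I \<rightarrow>\<^sub>E S" using v by simp
    obtain T d where d: "0 < d"
      "\<And>x y. x \<in> cadlag_paths S \<Longrightarrow> y \<in> skorohod_nbhd S x T d \<Longrightarrow> \<bar>h x - h y\<bar> < e"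
      using h e unfolding skorohod_ucont_def by blast
    define U where "U = Pi\<^sub>E ?I (\<lambda>i. S \<inter> ball (v i) d)"
    have gc: "grid_path k w \<in> cadlag_paths S" if "w \<in> ?I \<rightarrow>\<^sub>E S" for w
      using that by (intro grid_path_cadlag k) (auto simp: PiE_def Pi_def less_Suc_eq_le)
    have "openin (product_topology (\<lambda>_. top_of_set S) ?I) U"
      unfolding U_def by (subst openin_PiE) (auto intro!: openin_open_Int)
    moreover have "v \<in> U" using vS d unfolding U_def by (auto simp: PiE_def Pi_def)
    moreover have "h (grid_path k w) \<in> Met_TC.mball (h (grid_path k v)) e" if w: "w \<in> U" for w
    proof -
      have wS: "w \<in> ?I \<rightarrow>\<^sub>E S" using w unfolding U_def by (auto simp: PiE_def Pi_def)
      have "dist (w i) (v i) < d" if "i \<le> k * k" for i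
        using w that unfolding U_def by (auto simp: PiE_def Pi_def dist_commute less_Suc_eq_le)
      then have "grid_path k w \<in> skorohod_nbhd S (grid_path k v) T d"
        unfolding skorohod_nbhd_def using gc[OF wS] d id_time_change
        by (auto simp: grid_path_def intro!: bexI[of _ "\<lambda>s. s"])
      then show ?thesis using d(2)[OF gc[OF vS]] by (simp add: dist_real_def)
    qed
    ultimately show ?thesis by blast
  qed
  then show ?thesis
    using Met_TC.continuous_map_to_metric[of "product_topology (\<lambda>_. top_of_set S) ?I" "\<lambda>v. h (grid_path k v)"]
    by auto
qed

lemma continuous_map_borel_of_measurable:
  fixes g :: "'b \<Rightarrow> real"
  assumes "continuous_map T euclideanreal g"
  shows "g \<in> borel_of T \<rightarrow>\<^sub>M borel"
proof (rule borel_measurableI)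
  fix A :: "real set" assume "open A"
  then have "openin T {x \<in> topspace T. g x \<in> A}"
    using assms by (intro openin_continuous_map_preimage) auto
  moreover have "g -` A \<inter> space (borel_of T) = {x \<in> topspace T. g x \<in> A}"
    unfolding borel_of_def by (subst space_measure_of) (auto dest: openin_subset)
  ultimately show "g -` A \<inter> space (borel_of T) \<in> sets (borel_of T)"
    unfolding borel_of_def by (subst sets_measure_of) (auto dest: openin_subset)
qed

lemma discretize_sample_path:
  "discretize k (sample_path X \<omega>) = grid_path k (\<lambda>i\<in>{..<Suc (k * k)}. X (real i / real k) \<omega>)"
  unfolding discretize_def grid_path_def sample_path_def by (auto simp: less_Suc_eq_le intro!: ext)

text \<open>Measurability of the marginals in the sense in which finite-dimensional convergence supplies it.\<close>

definition fdd_measurable ::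
    "'w measure \<Rightarrow> 'b::metric_space set \<Rightarrow> (real \<Rightarrow> 'w \<Rightarrow> 'b) \<Rightarrow> bool" where
  "fdd_measurable M S X \<longleftrightarrow> (\<forall>\<omega>\<in>space M. sample_path X \<omega> \<in> cadlag_paths S) \<and>
     (\<forall>m (t :: nat \<Rightarrow> real). (\<forall>i<m. 0 \<le> t i) \<longrightarrow>
       (\<lambda>\<omega>. \<lambda>i\<in>{..<m}. X (t i) \<omega>) \<in> M \<rightarrow>\<^sub>M borel_of (product_topology (\<lambda>_. top_of_set S) {..<m}))"

lemma ucont_discretize_measurable:
  assumes X: "fdd_measurable M S X" and h: "skorohod_ucont S h" and k: "0 < k"
  shows "(\<lambda>\<omega>. h (discretize k (sample_path X \<omega>))) \<in> borel_measurable M"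
proof -
  have "(\<lambda>\<omega>. \<lambda>i\<in>{..<Suc (k * k)}. X (real i / real k) \<omega>)
      \<in> M \<rightarrow>\<^sub>M borel_of (product_topology (\<lambda>_. top_of_set S) {..<Suc (k * k)})"
    using X unfolding fdd_measurable_def by (elim conjE allE[of _ "Suc (k * k)"] allE[of _ "\<lambda>i. real i / real k"]) auto
  from measurable_comp[OF this continuous_map_borel_of_measurable[OF continuous_map_ucont_grid_path[OF h k]]]
  show ?thesis unfolding discretize_sample_path comp_def .
qed

lemma ucont_sample_path_measurable:
  assumes X: "fdd_measurable M S X" and h: "skorohod_ucont S h"
  shows "(\<lambda>\<omega>. h (sample_path X \<omega>)) \<in> borel_measurable M"
proof (rule borel_measurable_LIMSEQ_real)
  show "(\<lambda>k. h (discretize (Suc k) (sample_path X \<omega>))) \<longlonglongrightarrow> h (sample_path X \<omega>)" if "\<omega> \<in> space M" for \<omega>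
    using skorohod_ucont_discretize_tendsto[OF h, of "sample_path X \<omega>"] X that
    unfolding fdd_measurable_def by (intro LIMSEQ_Suc) auto
  show "(\<lambda>\<omega>. h (discretize (Suc k) (sample_path X \<omega>))) \<in> borel_measurable M" for k
    by (rule ucont_discretize_measurable[OF X h]) simp
qed

text \<open>The indicator of an open set is lower semicontinuous, hence a limit of uniformly continuous
  functionals, and each of these is a limit of functions of finitely many coordinates along the
  discretizations.\<close>

lemma sample_path_measurable:
  assumes X: "fdd_measurable M S X"
  shows "sample_path X \<in> M \<rightarrow>\<^sub>M borel_of (skorohod_topology S)"
  unfolding borel_of_def
proof (rule measurable_measure_of)
  show "{U. openin (skorohod_topology S) U} \<subseteq> Pow (topspace (skorohod_topology S))"
    using openin_subset by blast
  show "sample_path X \<in> space M \<rightarrow> topspace (skorohod_topology S)"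
    using X unfolding fdd_measurable_def by auto
  fix U assume "U \<in> {U. openin (skorohod_topology S) U}"
  then have U: "skorohod_lsc S (indicator U)" by (simp add: skorohod_lsc_indicator)
  obtain u where u: "\<And>m. skorohod_ucont S (u m)"
    "\<And>x. x \<in> cadlag_paths S \<Longrightarrow> (\<lambda>m. u m x) \<longlonglongrightarrow> (indicator U x :: real)"
  proof (rule skorohod_lsc_approx[OF U, of 0])
    show "- 0 \<le> (indicator U x :: real)" for x by simp
  qed (rule that)
  have "(\<lambda>\<omega>. indicator U (sample_path X \<omega>) :: real) \<in> borel_measurable M"
  proof (rule borel_measurable_LIMSEQ_real)
    show "(\<lambda>m. u m (sample_path X \<omega>)) \<longlonglongrightarrow> indicator U (sample_path X \<omega>)" if "\<omega> \<in> space M" for \<omega>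
      using u(2) X that unfolding fdd_measurable_def by auto
  qed (rule ucont_sample_path_measurable[OF X u(1)])
  then have "(\<lambda>\<omega>. indicator U (sample_path X \<omega>) :: real) -` {0<..} \<inter> space M \<in> sets M"
    by (rule measurable_sets) simp
  also have "(\<lambda>\<omega>. indicator U (sample_path X \<omega>) :: real) -` {0<..} \<inter> space M = sample_path X -` U \<inter> space M"
    by (auto simp: indicator_def split: if_splits)
  finally show "sample_path X -` U \<inter> space M \<in> sets M" .
qed

section \<open>Convergence in distribution from uniform discretization\<close>

lemma converges_in_fdd_measurable:
  assumes "converges_in_fdd S M X N Y"
    and "\<And>n \<omega>. \<omega> \<in> space (M n) \<Longrightarrow> sample_path (X n) \<omega> \<in> cadlag_paths S"
    and "\<And>\<omega>. \<omega> \<in> space N \<Longrightarrow> sample_path Y \<omega> \<in> cadlag_paths S"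
  shows "fdd_measurable (M n) S (X n)" and "fdd_measurable N S Y"
  using assms unfolding converges_in_fdd_def converges_in_distribution_def fdd_measurable_def by auto

lemma converges_in_fdd_grid_path:
  assumes conv: "converges_in_fdd S M X N Y" and h: "skorohod_ucont S h" and k: "0 < k"
    and B: "\<And>x. x \<in> cadlag_paths S \<Longrightarrow> \<bar>h x\<bar> \<le> B"
  shows "(\<lambda>n. \<integral>\<omega>. h (discretize k (sample_path (X n) \<omega>)) \<partial>M n)
    \<longlonglongrightarrow> (\<integral>\<omega>. h (discretize k (sample_path Y \<omega>)) \<partial>N)"
proof -
  let ?T = "product_topology (\<lambda>_. top_of_set S) {..<Suc (k * k)}"
  have "bounded ((\<lambda>v. h (grid_path k v)) ` topspace ?T)"
  proof (rule boundedI)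
    fix r assume "r \<in> (\<lambda>v. h (grid_path k v)) ` topspace ?T"
    then obtain v where "r = h (grid_path k v)" "v \<in> {..<Suc (k * k)} \<rightarrow>\<^sub>E S" by auto
    moreover from this have "grid_path k v \<in> cadlag_paths S"
      by (intro grid_path_cadlag k) (auto simp: PiE_def Pi_def less_Suc_eq_le)
    ultimately show "norm r \<le> B" using B by auto
  qed
  with continuous_map_ucont_grid_path[OF h k] have
    "(\<lambda>n. \<integral>\<omega>. h (grid_path k (\<lambda>i\<in>{..<Suc (k * k)}. X n (real i / real k) \<omega>)) \<partial>M n)
    \<longlonglongrightarrow> (\<integral>\<omega>. h (grid_path k (\<lambda>i\<in>{..<Suc (k * k)}. Y (real i / real k) \<omega>)) \<partial>N)"
    using conv unfolding converges_in_fdd_def converges_in_distribution_def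
    by (elim allE[of _ "Suc (k * k)"] allE[of _ "\<lambda>i. real i / real k"]) auto
  then show ?thesis unfolding discretize_sample_path .
qed

lemma ucont_integral_discretize_tendsto:
  fixes X :: "real \<Rightarrow> 'w \<Rightarrow> 'b::metric_space"
  assumes "prob_space M" and X: "fdd_measurable M S X" and h: "skorohod_ucont S h"
    and B: "\<And>x. x \<in> cadlag_paths S \<Longrightarrow> \<bar>h x\<bar> \<le> B" and r: "strict_mono r" "\<And>j. 0 < r j"
  shows "(\<lambda>j. \<integral>\<omega>. h (discretize (r j) (sample_path X \<omega>)) \<partial>M) \<longlonglongrightarrow> (\<integral>\<omega>. h (sample_path X \<omega>) \<partial>M)"
proof -
  interpret prob_space M by fact
  have path: "sample_path X \<omega> \<in> cadlag_paths S" if "\<omega> \<in> space M" for \<omega>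
    using X that unfolding fdd_measurable_def by auto
  show ?thesis
  proof (rule integral_dominated_convergence[where w = "\<lambda>_. B"])
    show "(\<lambda>\<omega>. h (sample_path X \<omega>)) \<in> borel_measurable M"
      by (rule ucont_sample_path_measurable[OF X h])
    show "(\<lambda>\<omega>. h (discretize (r j) (sample_path X \<omega>))) \<in> borel_measurable M" for j
      by (rule ucont_discretize_measurable[OF X h r(2)])
    show "AE \<omega> in M. (\<lambda>j. h (discretize (r j) (sample_path X \<omega>))) \<longlonglongrightarrow> h (sample_path X \<omega>)"
      using LIMSEQ_subseq_LIMSEQ[OF skorohod_ucont_discretize_tendsto[OF h path] r(1)]
      by (intro AE_I2) (simp add: comp_def)
    show "AE \<omega> in M. norm (h (discretize (r j) (sample_path X \<omega>))) \<le> B" for j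
      by (intro AE_I2) (auto intro!: B discretize_cadlag path r(2))
  qed simp
qed

text \<open>Three approximations are chained. The process \<open>X n\<close> is compared with its discretization on the grid
  \<open>1 / k\<close>, uniformly in \<open>n\<close>; the discretizations converge as \<open>n\<close> grows by the finite-dimensional
  convergence; and the discretization of \<open>Y\<close> tends to \<open>Y\<close> by dominated convergence. For the first
  comparison the hypothesis speaks only of a coarse and a finer grid: letting the finer
  one shrink at fixed \<open>n\<close> replaces it by the path itself.\<close>

lemma skorohod_ucont_integral_convergence:
  fixes M :: "nat \<Rightarrow> 'w measure" and X :: "nat \<Rightarrow> real \<Rightarrow> 'w \<Rightarrow> 'b::metric_space"
    and N :: "'v measure" and Y :: "real \<Rightarrow> 'v \<Rightarrow> 'b"
  assumes M: "\<And>n. prob_space (M n)" and N: "prob_space N"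
    and X: "\<And>n. fdd_measurable (M n) S (X n)" and Y: "fdd_measurable N S Y"
    and fdd: "converges_in_fdd S M X N Y"
    and unif: "\<And>T d e. 0 < d \<Longrightarrow> 0 < e \<Longrightarrow> \<exists>k0 n0. \<forall>k\<ge>k0. \<forall>n\<ge>n0. \<forall>j>0. \<exists>G\<in>sets (M n).
        measure (M n) (space (M n) - G) \<le> e \<and>
        (\<forall>\<omega>\<in>G. discretize (k * j) (sample_path (X n) \<omega>) \<in> skorohod_nbhd S (discretize k (sample_path (X n) \<omega>)) T d)"
    and h: "skorohod_ucont S h" and B: "\<And>x. x \<in> cadlag_paths S \<Longrightarrow> \<bar>h x\<bar> \<le> B"
  shows "(\<lambda>n. \<integral>\<omega>. h (sample_path (X n) \<omega>) \<partial>M n) \<longlonglongrightarrow> (\<integral>\<omega>. h (sample_path Y \<omega>) \<partial>N)"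
proof (rule LIMSEQ_I)
  fix e :: real assume e: "0 < e"
  define E where "E n k = (\<integral>\<omega>. h (discretize k (sample_path (X n) \<omega>)) \<partial>M n)" for n k
  define b where "b = max B 0"
  have b: "0 \<le> b" "\<And>x. x \<in> cadlag_paths S \<Longrightarrow> \<bar>h x\<bar> \<le> b" using B unfolding b_def by fastforce+
  define p where "p = e / (16 * (b + 1))"
  have p: "0 < p" "2 * b * p \<le> e / 8"
  proof -
    show "0 < p" unfolding p_def using e b by auto
    then have "2 * b * p \<le> 2 * (b + 1) * p" by (intro mult_right_mono) auto
    also have "\<dots> = e / 8" unfolding p_def using b(1) by (simp add: field_simps)
    finally show "2 * b * p \<le> e / 8" .
  qed
  have e8: "0 < e / 8" using e by simp
  have "\<exists>T. \<exists>d>0. \<forall>x\<in>cadlag_paths S. \<forall>y\<in>skorohod_nbhd S x T d. \<bar>h x - h y\<bar> < e / 8"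
    by (rule h[unfolded skorohod_ucont_def, THEN spec, THEN mp, OF e8])
  then obtain T d where d: "0 < d"
    "\<And>x y. x \<in> cadlag_paths S \<Longrightarrow> y \<in> skorohod_nbhd S x T d \<Longrightarrow> \<bar>h x - h y\<bar> < e / 8"
    by metis
  obtain k0 n0 where kn: "\<And>k n j. k0 \<le> k \<Longrightarrow> n0 \<le> n \<Longrightarrow> 0 < j \<Longrightarrow> \<exists>G\<in>sets (M n).
        measure (M n) (space (M n) - G) \<le> p \<and>
        (\<forall>\<omega>\<in>G. discretize (k * j) (sample_path (X n) \<omega>) \<in> skorohod_nbhd S (discretize k (sample_path (X n) \<omega>)) T d)"
    using unif[OF d(1) p(1), of T] by metis
  have path: "sample_path (X n) \<omega> \<in> cadlag_paths S" if "\<omega> \<in> space (M n)" for n \<omega>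
    using X[of n] that unfolding fdd_measurable_def by auto
  have coarse: "\<bar>E n k - E n (k * j)\<bar> \<le> e / 4" if k: "k0 \<le> k" "0 < k" and n: "n0 \<le> n" and j: "0 < j" for n k j
  proof -
    interpret prob_space "M n" by (rule M)
    obtain G where G: "G \<in> sets (M n)" "measure (M n) (space (M n) - G) \<le> p"
      "\<And>\<omega>. \<omega> \<in> G \<Longrightarrow> discretize (k * j) (sample_path (X n) \<omega>) \<in> skorohod_nbhd S (discretize k (sample_path (X n) \<omega>)) T d"
      using kn[OF k(1) n j] by blast
    let ?F = "\<lambda>k \<omega>. h (discretize k (sample_path (X n) \<omega>))"
    have bnd: "\<bar>?F k \<omega>\<bar> \<le> b" if "\<omega> \<in> space (M n)" "0 < k" for k \<omega>
      using that by (intro b(2) discretize_cadlag path)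
    have int: "integrable (M n) (?F k)" if "0 < k" for k
      using bnd that by (intro integrable_const_bound[of _ b] AE_I2 ucont_discretize_measurable[OF X h]) auto
    have kj: "0 < k * j" using k j by auto
    (* On G uniform continuity applies; off G only the bound b does. *)
    have pw: "\<bar>?F k \<omega> - ?F (k * j) \<omega>\<bar> \<le> e / 8 + 2 * b * indicator (space (M n) - G) \<omega>"
      if \<omega>: "\<omega> \<in> space (M n)" for \<omega>
    proof (cases "\<omega> \<in> G")
      case True
      then show ?thesis using d(2)[OF discretize_cadlag[OF k(2) path[OF \<omega>]] G(3)[OF True]] by simp
    next
      case False
      then show ?thesis using bnd[OF \<omega> k(2)] bnd[OF \<omega> kj] \<omega> e by simp
    qed
    have "\<bar>E n k - E n (k * j)\<bar> = \<bar>\<integral>\<omega>. ?F k \<omega> - ?F (k * j) \<omega> \<partial>M n\<bar>"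
      unfolding E_def using int[OF k(2)] int[OF kj] by simp
    also have "\<dots> \<le> (\<integral>\<omega>. \<bar>?F k \<omega> - ?F (k * j) \<omega>\<bar> \<partial>M n)" by (rule integral_abs_bound)
    also have "\<dots> \<le> (\<integral>\<omega>. e / 8 + 2 * b * indicator (space (M n) - G) \<omega> \<partial>M n)"
      using int[OF k(2)] int[OF kj] G(1) pw by (intro integral_mono) (auto intro!: integrable_real_mult_indicator simp: integrable_const)
    also have "\<dots> = e / 8 + 2 * b * measure (M n) (space (M n) - G)"
      using G(1) sets.sets_into_space[of "space (M n) - G" "M n"]
      by (subst Bochner_Integration.integral_add)
        (auto simp: prob_space Int_absorb1 less_top[symmetric] intro!: integrable_real_mult_indicator integrable_mult_right)
    also have "\<dots> \<le> e / 8 + 2 * b * p" using G(2) b(1) by (intro add_left_mono mult_left_mono) auto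
    also have "\<dots> \<le> e / 4" using p(2) by simp
    finally show ?thesis .
  qed
  have fine: "\<bar>E n k - (\<integral>\<omega>. h (sample_path (X n) \<omega>) \<partial>M n)\<bar> \<le> e / 4"
    if k: "k0 \<le> k" "0 < k" and n: "n0 \<le> n" for n k
  proof (rule LIMSEQ_le_const2)
    have "(\<lambda>j. E n (k * Suc j)) \<longlonglongrightarrow> (\<integral>\<omega>. h (sample_path (X n) \<omega>) \<partial>M n)"
      unfolding E_def using k(2)
      by (intro ucont_integral_discretize_tendsto[OF M X h b(2)]) (auto intro!: strict_monoI)
    then show "(\<lambda>j. \<bar>E n k - E n (k * Suc j)\<bar>) \<longlonglongrightarrow> \<bar>E n k - (\<integral>\<omega>. h (sample_path (X n) \<omega>) \<partial>M n)\<bar>"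
      by (intro tendsto_intros)
    show "\<exists>N. \<forall>j\<ge>N. \<bar>E n k - E n (k * Suc j)\<bar> \<le> e / 4" using coarse[OF k n] by blast
  qed
  have "(\<lambda>j. \<integral>\<omega>. h (discretize (Suc j) (sample_path Y \<omega>)) \<partial>N) \<longlonglongrightarrow> (\<integral>\<omega>. h (sample_path Y \<omega>) \<partial>N)"
    by (intro ucont_integral_discretize_tendsto[OF N Y h b(2)]) (auto intro!: strict_monoI)
  then obtain j0 where j0: "\<And>j. j0 \<le> j \<Longrightarrow>
      \<bar>(\<integral>\<omega>. h (discretize (Suc j) (sample_path Y \<omega>)) \<partial>N) - (\<integral>\<omega>. h (sample_path Y \<omega>) \<partial>N)\<bar> < e / 4"
    using LIMSEQ_D[of _ _ "e / 4"] e by fastforce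
  define k where "k = Suc (max j0 k0)"
  have k: "0 < k" "k0 \<le> k" unfolding k_def by auto
  have Yk: "\<bar>(\<integral>\<omega>. h (discretize k (sample_path Y \<omega>)) \<partial>N) - (\<integral>\<omega>. h (sample_path Y \<omega>) \<partial>N)\<bar> < e / 4"
    unfolding k_def by (rule j0) simp
  have "(\<lambda>n. E n k) \<longlonglongrightarrow> (\<integral>\<omega>. h (discretize k (sample_path Y \<omega>)) \<partial>N)"
    unfolding E_def by (rule converges_in_fdd_grid_path[OF fdd h k(1) b(2)])
  then obtain n1 where n1: "\<And>n. n1 \<le> n \<Longrightarrow> \<bar>E n k - (\<integral>\<omega>. h (discretize k (sample_path Y \<omega>)) \<partial>N)\<bar> < e / 4"
    using LIMSEQ_D[of _ _ "e / 4"] e by fastforce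
  have "norm ((\<integral>\<omega>. h (sample_path (X n) \<omega>) \<partial>M n) - (\<integral>\<omega>. h (sample_path Y \<omega>) \<partial>N)) < e" if "max n0 n1 \<le> n" for n
  proof -
    have n: "n0 \<le> n" "n1 \<le> n" using that by auto
    show ?thesis using fine[OF k(2,1) n(1)] n1[OF n(2)] Yk e unfolding real_norm_def by linarith
  qed
  then show "\<exists>no. \<forall>n\<ge>no. norm ((\<integral>\<omega>. h (sample_path (X n) \<omega>) \<partial>M n) - (\<integral>\<omega>. h (sample_path Y \<omega>) \<partial>N)) < e"
    by blast
qed

text \<open>A continuous \<open>f\<close> is the limit from below of uniformly continuous functionals, which gives the lower
  bound for the limit inferior of the expectations. The same bound for \<open>- f\<close> is the upper bound.\<close>

lemma skorohod_convergence_of_ucont: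
  fixes M :: "nat \<Rightarrow> 'w measure" and X :: "nat \<Rightarrow> real \<Rightarrow> 'w \<Rightarrow> 'b::metric_space"
    and N :: "'v measure" and Y :: "real \<Rightarrow> 'v \<Rightarrow> 'b"
  assumes M: "\<And>n. prob_space (M n)" and N: "prob_space N"
    and X: "\<And>n. fdd_measurable (M n) S (X n)" and Y: "fdd_measurable N S Y"
    and ucont: "\<And>h B. skorohod_ucont S h \<Longrightarrow> (\<And>x. x \<in> cadlag_paths S \<Longrightarrow> \<bar>h x\<bar> \<le> B) \<Longrightarrow>
      (\<lambda>n. \<integral>\<omega>. h (sample_path (X n) \<omega>) \<partial>M n) \<longlonglongrightarrow> (\<integral>\<omega>. h (sample_path Y \<omega>) \<partial>N)"
  shows "converges_in_distribution (skorohod_topology S) M (\<lambda>n. sample_path (X n)) N (sample_path Y)"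
  unfolding converges_in_distribution_def
proof (intro conjI allI impI)
  show "sample_path (X n) \<in> M n \<rightarrow>\<^sub>M borel_of (skorohod_topology S)" for n
    by (rule sample_path_measurable[OF X])
  show "sample_path Y \<in> N \<rightarrow>\<^sub>M borel_of (skorohod_topology S)"
    by (rule sample_path_measurable[OF Y])
  fix f :: "(real \<Rightarrow> 'b) \<Rightarrow> real"
  assume f: "continuous_map (skorohod_topology S) euclideanreal f \<and> bounded (f ` topspace (skorohod_topology S))"
  then obtain B where B: "\<And>x. x \<in> cadlag_paths S \<Longrightarrow> \<bar>f x\<bar> \<le> B" unfolding bounded_iff by auto
  have pathX: "sample_path (X n) \<omega> \<in> cadlag_paths S" if "\<omega> \<in> space (M n)" for n \<omega>
    using X[of n] that unfolding fdd_measurable_def by auto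
  have pathY: "sample_path Y \<omega> \<in> cadlag_paths S" if "\<omega> \<in> space N" for \<omega>
    using Y that unfolding fdd_measurable_def by auto
  have lower: "\<forall>\<^sub>F n in sequentially. (\<integral>\<omega>. g (sample_path Y \<omega>) \<partial>N) - e < (\<integral>\<omega>. g (sample_path (X n) \<omega>) \<partial>M n)"
    if g: "continuous_map (skorohod_topology S) euclideanreal g" and gB: "\<And>x. x \<in> cadlag_paths S \<Longrightarrow> \<bar>g x\<bar> \<le> B"
      and e: "0 < e" for g e
  proof -
    have lowerB: "- B \<le> g x" if "x \<in> cadlag_paths S" for x using gB[OF that] by auto
    obtain u where u: "\<And>m. skorohod_ucont S (u m)"
      "\<And>m x. x \<in> cadlag_paths S \<Longrightarrow> - B \<le> u m x \<and> u m x \<le> g x"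
      "\<And>x. x \<in> cadlag_paths S \<Longrightarrow> (\<lambda>m. u m x) \<longlonglongrightarrow> g x"
      using skorohod_lsc_approx[OF skorohod_lsc_continuous_map[OF g] lowerB] by blast
    have uB: "\<bar>u m x\<bar> \<le> B" if "x \<in> cadlag_paths S" for m x
      using u(2)[OF that, of m] gB[OF that] by auto
    have measX: "(\<lambda>\<omega>. g (sample_path (X n) \<omega>)) \<in> borel_measurable (M n)" for n
      using measurable_comp[OF sample_path_measurable[OF X] continuous_map_borel_of_measurable[OF g]]
      by (simp add: comp_def)
    have measY: "(\<lambda>\<omega>. g (sample_path Y \<omega>)) \<in> borel_measurable N"
      using measurable_comp[OF sample_path_measurable[OF Y] continuous_map_borel_of_measurable[OF g]]
      by (simp add: comp_def)
    have "(\<lambda>m. \<integral>\<omega>. u m (sample_path Y \<omega>) \<partial>N) \<longlonglongrightarrow> (\<integral>\<omega>. g (sample_path Y \<omega>) \<partial>N)"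
    proof (rule integral_dominated_convergence[where w = "\<lambda>_. B"])
      interpret prob_space N by (rule N)
      show "integrable N (\<lambda>_. B)" by simp
      show "(\<lambda>\<omega>. u m (sample_path Y \<omega>)) \<in> borel_measurable N" for m
        by (rule ucont_sample_path_measurable[OF Y u(1)])
    qed (auto intro!: AE_I2 measY u(3) uB pathY)
    then have "\<forall>\<^sub>F m in sequentially. (\<integral>\<omega>. g (sample_path Y \<omega>) \<partial>N) - e < (\<integral>\<omega>. u m (sample_path Y \<omega>) \<partial>N)"
      using e by (intro order_tendstoD(1)) auto
    then obtain m where m: "(\<integral>\<omega>. g (sample_path Y \<omega>) \<partial>N) - e < (\<integral>\<omega>. u m (sample_path Y \<omega>) \<partial>N)"
      by (auto simp: eventually_sequentially)
    have "\<forall>\<^sub>F n in sequentially. (\<integral>\<omega>. g (sample_path Y \<omega>) \<partial>N) - e < (\<integral>\<omega>. u m (sample_path (X n) \<omega>) \<partial>M n)"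
      by (rule order_tendstoD(1)[OF ucont[OF u(1) uB] m])
    then show ?thesis
    proof eventually_elim
      case (elim n)
      interpret prob_space "M n" by (rule M)
      have "(\<integral>\<omega>. u m (sample_path (X n) \<omega>) \<partial>M n) \<le> (\<integral>\<omega>. g (sample_path (X n) \<omega>) \<partial>M n)"
      proof (rule integral_mono)
        show "integrable (M n) (\<lambda>\<omega>. u m (sample_path (X n) \<omega>))"
          using uB pathX by (intro integrable_const_bound[of _ B] AE_I2 ucont_sample_path_measurable[OF X u(1)]) auto
        show "integrable (M n) (\<lambda>\<omega>. g (sample_path (X n) \<omega>))"
          using gB pathX by (intro integrable_const_bound[of _ B] AE_I2 measX) auto
      qed (use u(2) pathX in auto)
      then show ?case using elim by linarith
    qed
  qed
  show "(\<lambda>n. \<integral>\<omega>. f (sample_path (X n) \<omega>) \<partial>M n) \<longlonglongrightarrow> (\<integral>\<omega>. f (sample_path Y \<omega>) \<partial>N)"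
  proof (rule tendstoI)
    fix e :: real assume e: "0 < e"
    have neg: "continuous_map (skorohod_topology S) euclideanreal (\<lambda>x. - f x)"
      using f by (intro continuous_map_minus) auto
    have "\<forall>\<^sub>F n in sequentially. (\<integral>\<omega>. f (sample_path Y \<omega>) \<partial>N) - e < (\<integral>\<omega>. f (sample_path (X n) \<omega>) \<partial>M n)"
      using f B e by (intro lower) auto
    moreover have "\<forall>\<^sub>F n in sequentially. (\<integral>\<omega>. - f (sample_path Y \<omega>) \<partial>N) - e < (\<integral>\<omega>. - f (sample_path (X n) \<omega>) \<partial>M n)"
      using B e neg by (intro lower[of "\<lambda>x. - f x"]) auto
    ultimately show "\<forall>\<^sub>F n in sequentially. dist (\<integral>\<omega>. f (sample_path (X n) \<omega>) \<partial>M n) (\<integral>\<omega>. f (sample_path Y \<omega>) \<partial>N) < e"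
      by eventually_elim (simp add: dist_real_def abs_less_iff)
  qed
qed

section \<open>The stopping time condition\<close>

lemma sum_squares_measurable [measurable]: "sum_squares \<in> borel_measurable borel"
proof -
  have [measurable]: "(\<lambda>x :: nat \<Rightarrow> real. x i) \<in> borel_measurable borel" for i
    by (intro borel_measurable_continuous_onI continuous_on_product_coordinates)
  show ?thesis unfolding sum_squares_def by measurable
qed

text \<open>The real version of \<open>Q\<close> in the theorem: where the sum of squares is infinite it is 0, and so it
  is known to be monotone in time on the almost sure event that \<open>Q\<close> is finite at time 0.\<close>

definition square_mass :: "(real \<Rightarrow> 'w \<Rightarrow> (nat \<Rightarrow> real)) \<Rightarrow> real \<Rightarrow> 'w \<Rightarrow> real" where
  "square_mass X t \<omega> = enn2real (sum_squares (X t \<omega>))"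

lemma space_natural_filtration [simp]: "space (natural_filtration M X t) = space M"
  unfolding natural_filtration_def by (subst space_measure_of) auto

lemma natural_filtration_measurable:
  assumes "0 \<le> s" "s \<le> t"
  shows "X s \<in> natural_filtration M X t \<rightarrow>\<^sub>M borel"
proof (rule measurableI)
  fix A :: "'b::topological_space set" assume "A \<in> sets borel"
  then have "X s -` A \<inter> space M \<in> {X s -` B \<inter> space M | s B. s \<in> {0..t} \<and> B \<in> sets borel}"
    using assms by auto
  then show "X s -` A \<inter> space (natural_filtration M X t) \<in> sets (natural_filtration M X t)"
    unfolding space_natural_filtration unfolding natural_filtration_def
    by (subst sets_measure_of) auto
qed simp

lemma sets_natural_filtration_subset:
  assumes "\<And>s. 0 \<le> s \<Longrightarrow> X s \<in> borel_measurable M"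
  shows "sets (natural_filtration M X t) \<subseteq> sets M"
  unfolding natural_filtration_def
  by (subst sets_measure_of) (auto intro!: sets.sigma_sets_subset measurable_sets[OF assms])

lemma natural_stopping_time_measurable:
  assumes "\<And>s. 0 \<le> s \<Longrightarrow> X s \<in> borel_measurable M" "stopping_time (natural_filtration M X) \<tau>"
  shows "\<tau> \<in> borel_measurable (M :: 'w measure)"
  using assms(2)
proof (rule measurable_stopping_time)
  show "sets (natural_filtration M X t) \<subseteq> sets M" for t
    by (rule sets_natural_filtration_subset[OF assms(1)])
qed simp

lemma measurable_at_simple_time:
  fixes X :: "real \<Rightarrow> 'w \<Rightarrow> 'b::topological_space"
  assumes X: "\<And>s. 0 \<le> s \<Longrightarrow> X s \<in> borel_measurable M" and \<tau>: "\<tau> \<in> borel_measurable M"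
    and fin: "finite (\<tau> ` space M)" and pos: "\<And>\<omega>. \<omega> \<in> space M \<Longrightarrow> 0 \<le> \<tau> \<omega>" and h: "0 \<le> h"
  shows "(\<lambda>\<omega>. X (\<tau> \<omega> + h) \<omega>) \<in> borel_measurable M"
proof (rule measurable_compose_countable'[where f = "\<lambda>i. X (i + h)" and g = \<tau> and I = "\<tau> ` space M"])
  show "X (i + h) \<in> borel_measurable M" if "i \<in> \<tau> ` space M" for i
    using that pos h by (auto intro!: X)
  show "countable (\<tau> ` space M)" using fin by (rule countable_finite)
  show "\<tau> \<in> M \<rightarrow>\<^sub>M count_space (\<tau> ` space M)"
    using fin \<tau> by (subst measurable_count_space_eq_countable[OF countable_finite]) (auto intro: measurable_sets)
qed

lemma fragmentation_process_measurable:
  "fragmentation_process M X \<Longrightarrow> 0 \<le> s \<Longrightarrow> X s \<in> borel_measurable M"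
  unfolding fragmentation_process_def cadlag_process_def by auto

lemma fragmentation_process_path:
  "fragmentation_process M X \<Longrightarrow> \<omega> \<in> space M \<Longrightarrow> sample_path X \<omega> \<in> cadlag_paths Sdown"
  unfolding fragmentation_process_def cadlag_process_def by auto

lemma fragmentation_process_Sdown:
  assumes "fragmentation_process M X" "\<omega> \<in> space M" "0 \<le> t"
  shows "X t \<omega> \<in> Sdown"
  using fragmentation_process_path[OF assms(1,2)] assms(3)
  unfolding cadlag_paths_def sample_path_def by (auto simp: PiE_def Pi_def)

lemma fragmentation_process_le:
  assumes "fragmentation_process M X" "\<omega> \<in> space M" "0 \<le> s" "s \<le> t"
  shows "frag_le (X t \<omega>) (X s \<omega>)"
  using assms unfolding fragmentation_process_def by auto

lemma fragmentation_sum_squares_antimono: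
  assumes "fragmentation_process M X" "\<omega> \<in> space M" "0 \<le> s" "s \<le> t"
  shows "sum_squares (X t \<omega>) \<le> sum_squares (X s \<omega>)"
  using assms by (intro frag_le_sum_squares_mono fragmentation_process_le fragmentation_process_Sdown) auto

lemma fragmentation_sum_squares_finite:
  assumes "fragmentation_process M X" "\<omega> \<in> space M" "sum_squares (X 0 \<omega>) < \<infinity>" "0 \<le> t"
  shows "sum_squares (X t \<omega>) < \<infinity>"
  using fragmentation_sum_squares_antimono[OF assms(1,2) order_refl assms(4)] assms(3) by (rule le_less_trans)

lemma square_mass_antimono:
  assumes "fragmentation_process M X" "\<omega> \<in> space M" "sum_squares (X 0 \<omega>) < \<infinity>" "0 \<le> s" "s \<le> t"
  shows "square_mass X t \<omega> \<le> square_mass X s \<omega>"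
  unfolding square_mass_def
  using fragmentation_sum_squares_antimono[OF assms(1,2,4,5)] fragmentation_sum_squares_finite[OF assms(1-4)]
  by (intro enn2real_mono) auto

lemma fragmentation_dist_le:
  assumes X: "fragmentation_process M X" and \<omega>: "\<omega> \<in> space M" and fin: "sum_squares (X 0 \<omega>) < \<infinity>"
    and t: "0 \<le> s" "s \<le> t" and gap: "square_mass X s \<omega> - square_mass X t \<omega> < e\<^sup>2" and e: "0 \<le> e"
  shows "dist (X s \<omega>) (X t \<omega>) \<le> 2 * e"
proof (intro dist_le_coordinatewise frag_le_coordinate_gap)
  have f: "sum_squares (X s \<omega>) = ennreal (square_mass X s \<omega>)" "sum_squares (X t \<omega>) = ennreal (square_mass X t \<omega>)"
    using fragmentation_sum_squares_finite[OF X \<omega> fin] t unfolding square_mass_def by auto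
  have nn: "0 \<le> square_mass X t \<omega>" "0 \<le> square_mass X s \<omega>" unfolding square_mass_def by simp_all
  have "ennreal (square_mass X s \<omega>) < ennreal (square_mass X t \<omega> + e\<^sup>2)"
    using gap nn by (intro ennreal_lessI) linarith+
  then show "sum_squares (X s \<omega>) < sum_squares (X t \<omega>) + ennreal (e\<^sup>2)"
    unfolding f by (simp add: nn)
qed (use assms in \<open>auto intro: fragmentation_process_Sdown fragmentation_process_le\<close>)

text \<open>Aldous's condition for one process, at a fixed lag \<open>\<delta>\<close> and uniformly over the stopping times. Finite
  range makes the process at the stopping time measurable, and the drop times on a grid have it.\<close>

definition small_drops ::
    "'w measure \<Rightarrow> (real \<Rightarrow> 'w \<Rightarrow> (nat \<Rightarrow> real)) \<Rightarrow> real \<Rightarrow> real \<Rightarrow> real \<Rightarrow> real \<Rightarrow> bool" where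
  "small_drops M X C \<eta> \<delta> p \<longleftrightarrow>
     (\<forall>\<tau>. stopping_time (natural_filtration M X) \<tau> \<longrightarrow> finite (\<tau> ` space M) \<longrightarrow>
        (\<forall>\<omega>\<in>space M. 0 \<le> \<tau> \<omega> \<and> \<tau> \<omega> \<le> C) \<longrightarrow>
        measure M {\<omega>\<in>space M. \<eta> < \<bar>square_mass X (\<tau> \<omega>) \<omega> - square_mass X (\<tau> \<omega> + \<delta>) \<omega>\<bar>} \<le> p)"

text \<open>Almost surely the drop is nonnegative, so this is Markov's inequality. An infinite expectation
  at the earlier time is excluded since the difference of expectations would then be infinite.\<close>

lemma drop_probability_le_expectation:
  assumes "prob_space M" and X: "fragmentation_process M X"
    and fin: "AE \<omega> in M. sum_squares (X 0 \<omega>) < \<infinity>"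
    and \<tau>: "\<tau> \<in> borel_measurable M" "finite (\<tau> ` space M)" "\<And>\<omega>. \<omega> \<in> space M \<Longrightarrow> 0 \<le> \<tau> \<omega>"
    and h: "0 \<le> h" and \<eta>: "0 < \<eta>"
    and not_both: "\<not> ((\<integral>\<^sup>+\<omega>. sum_squares (X (\<tau> \<omega>) \<omega>) \<partial>M) = \<infinity> \<and> (\<integral>\<^sup>+\<omega>. sum_squares (X (\<tau> \<omega> + h) \<omega>) \<partial>M) = \<infinity>)"
    and less: "enn2ereal (\<integral>\<^sup>+\<omega>. sum_squares (X (\<tau> \<omega>) \<omega>) \<partial>M)
              - enn2ereal (\<integral>\<^sup>+\<omega>. sum_squares (X (\<tau> \<omega> + h) \<omega>) \<partial>M) < ereal c"
  shows "measure M {\<omega>\<in>space M. \<eta> < \<bar>square_mass X (\<tau> \<omega>) \<omega> - square_mass X (\<tau> \<omega> + h) \<omega>\<bar>} \<le> c / \<eta>"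
proof -
  interpret prob_space M by fact
  let ?f = "\<lambda>\<omega>. square_mass X (\<tau> \<omega>) \<omega>" and ?g = "\<lambda>\<omega>. square_mass X (\<tau> \<omega> + h) \<omega>"
  let ?F = "\<lambda>\<omega>. sum_squares (X (\<tau> \<omega>) \<omega>)" and ?G = "\<lambda>\<omega>. sum_squares (X (\<tau> \<omega> + h) \<omega>)"
  have Xm: "X s \<in> borel_measurable M" if "0 \<le> s" for s using X that by (rule fragmentation_process_measurable)
  have [measurable]: "(\<lambda>\<omega>. X (\<tau> \<omega> + h) \<omega>) \<in> borel_measurable M"
    using Xm \<tau> h by (rule measurable_at_simple_time)
  have [measurable]: "(\<lambda>\<omega>. X (\<tau> \<omega>) \<omega>) \<in> borel_measurable M"
    using measurable_at_simple_time[of X M \<tau> 0] Xm \<tau> by simp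
  have [measurable]: "?f \<in> borel_measurable M" "?g \<in> borel_measurable M"
    unfolding square_mass_def by measurable
  have GF: "integral\<^sup>N M ?G \<le> integral\<^sup>N M ?F"
    by (intro nn_integral_mono fragmentation_sum_squares_antimono[OF X]) (auto simp: \<tau>(3) h)
  have "integral\<^sup>N M ?F \<noteq> \<infinity>"
  proof
    assume inf: "integral\<^sup>N M ?F = \<infinity>"
    then have "integral\<^sup>N M ?G \<noteq> \<infinity>" using not_both by auto
    then obtain r where r: "0 \<le> r" "integral\<^sup>N M ?G = ennreal r" by (cases "integral\<^sup>N M ?G") auto
    show False using less unfolding inf r(2) using r(1) by (simp add: enn2ereal_ennreal)
  qed
  then obtain a b where ab: "0 \<le> a" "integral\<^sup>N M ?F = ennreal a" "0 \<le> b" "integral\<^sup>N M ?G = ennreal b"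
    using GF by (cases "integral\<^sup>N M ?F"; cases "integral\<^sup>N M ?G") (auto simp: top_unique)
  have ac: "a - b < c" using less unfolding ab(2,4) using ab(1,3) by (simp add: enn2ereal_ennreal)
  have "AE \<omega> in M. ?F \<omega> = ennreal (?f \<omega>) \<and> ?G \<omega> = ennreal (?g \<omega>) \<and> 0 \<le> ?f \<omega> - ?g \<omega>"
    using fin AE_space
  proof eventually_elim
    case (elim \<omega>)
    have t: "0 \<le> \<tau> \<omega>" "\<tau> \<omega> \<le> \<tau> \<omega> + h" "0 \<le> \<tau> \<omega> + h" using \<tau>(3)[OF elim(2)] h by auto
    show ?case
      using fragmentation_sum_squares_finite[OF X elim(2,1) t(1)]
        fragmentation_sum_squares_finite[OF X elim(2,1) t(3)] square_mass_antimono[OF X elim(2,1) t(1,2)]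
      unfolding square_mass_def by auto
  qed
  then have Ff: "AE \<omega> in M. ?F \<omega> = ennreal (?f \<omega>)" and Gg: "AE \<omega> in M. ?G \<omega> = ennreal (?g \<omega>)"
    and gf: "AE \<omega> in M. 0 \<le> ?f \<omega> - ?g \<omega>" by auto
  have "(\<integral>\<^sup>+\<omega>. ennreal (?f \<omega>) \<partial>M) = ennreal a" "(\<integral>\<^sup>+\<omega>. ennreal (?g \<omega>) \<partial>M) = ennreal b"
    using nn_integral_cong_AE[OF Ff] nn_integral_cong_AE[OF Gg] ab by auto
  then have "has_bochner_integral M ?f a" "has_bochner_integral M ?g b"
    using ab(1,3) by (auto intro!: has_bochner_integral_nn_integral AE_I2 simp: square_mass_def)
  then have int: "integrable M (\<lambda>\<omega>. ?f \<omega> - ?g \<omega>)" "integral\<^sup>L M (\<lambda>\<omega>. ?f \<omega> - ?g \<omega>) = a - b"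
    by (auto simp: has_bochner_integral_iff)
  have "measure M {\<omega>\<in>space M. \<eta> < \<bar>?f \<omega> - ?g \<omega>\<bar>} \<le> measure M {\<omega>\<in>space M. \<eta> \<le> ?f \<omega> - ?g \<omega>}"
  proof (rule finite_measure_mono_AE)
    show "AE \<omega> in M. \<omega> \<in> {\<omega>\<in>space M. \<eta> < \<bar>?f \<omega> - ?g \<omega>\<bar>} \<longrightarrow> \<omega> \<in> {\<omega>\<in>space M. \<eta> \<le> ?f \<omega> - ?g \<omega>}"
      using gf by eventually_elim auto
  qed measurable
  also have "\<dots> \<le> (a - b) / \<eta>"
    using integral_Markov_inequality_measure[OF int(1) sets.top gf \<eta>] int(2) by simp
  also have "\<dots> \<le> c / \<eta>" using ac \<eta> by (intro divide_right_mono) auto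
  finally show ?thesis .
qed

text \<open>Aldous's condition for sequences becomes a statement about all stopping times at once: were it
  false, bad stopping times \<open>\<sigma> j\<close> for the lags \<open>1 / (j + 1)\<close> would exist along a subsequence \<open>r\<close> of the
  processes, and the sequence that uses them along \<open>r\<close>, and the time 0 elsewhere, violates both
  alternatives of the hypothesis.\<close>

lemma uniformly_small_drops:
  fixes M :: "nat \<Rightarrow> 'w measure" and X :: "nat \<Rightarrow> real \<Rightarrow> 'w \<Rightarrow> (nat \<Rightarrow> real)"
  assumes M: "\<And>n. prob_space (M n)" and X: "\<And>n. fragmentation_process (M n) (X n)"
    and fin: "\<And>n. AE \<omega> in M n. sum_squares (X n 0 \<omega>) < \<infinity>"
    and cond: "\<And>(\<tau> :: nat \<Rightarrow> 'w \<Rightarrow> real) (h :: nat \<Rightarrow> real).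
       (\<forall>n. stopping_time (natural_filtration (M n) (X n)) (\<tau> n)) \<Longrightarrow>
       (\<exists>C. \<forall>n. \<forall>\<omega>\<in>space (M n). 0 \<le> \<tau> n \<omega> \<and> \<tau> n \<omega> \<le> C) \<Longrightarrow>
       (\<forall>n. 0 < h n) \<Longrightarrow> h \<longlonglongrightarrow> 0 \<Longrightarrow>
       tends_to_0_in_probability M
         (\<lambda>n \<omega>. enn2real (sum_squares (X n (\<tau> n \<omega>) \<omega>)) - enn2real (sum_squares (X n (\<tau> n \<omega> + h n) \<omega>)))
       \<or> ((\<forall>n. \<not> ((\<integral>\<^sup>+\<omega>. sum_squares (X n (\<tau> n \<omega>) \<omega>) \<partial>M n) = \<infinity> \<and> (\<integral>\<^sup>+\<omega>. sum_squares (X n (\<tau> n \<omega> + h n) \<omega>) \<partial>M n) = \<infinity>)) \<and>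
          (\<lambda>n. enn2ereal (\<integral>\<^sup>+\<omega>. sum_squares (X n (\<tau> n \<omega>) \<omega>) \<partial>M n)
              - enn2ereal (\<integral>\<^sup>+\<omega>. sum_squares (X n (\<tau> n \<omega> + h n) \<omega>) \<partial>M n)) \<longlonglongrightarrow> 0)"
    and C: "0 \<le> C" and \<eta>: "0 < \<eta>" and p: "0 < p"
  shows "\<exists>\<delta>>0. \<delta> \<le> 1 \<and> (\<exists>n0. \<forall>n\<ge>n0. small_drops (M n) (X n) C \<eta> \<delta> p)"
proof (rule ccontr)
  assume contra: "\<not> ?thesis"
  have bad: "\<exists>n\<ge>n0. \<not> small_drops (M n) (X n) C \<eta> (1 / real (Suc j)) p" for n0 j
  proof (rule ccontr)
    assume "\<not> ?thesis"
    then have "\<forall>n\<ge>n0. small_drops (M n) (X n) C \<eta> (1 / real (Suc j)) p" by blast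
    moreover have "0 < 1 / real (Suc j)" "1 / real (Suc j) \<le> 1" by auto
    ultimately show False using contra by blast
  qed
  have "\<exists>r. \<forall>j. \<not> small_drops (M (r j)) (X (r j)) C \<eta> (1 / real (Suc j)) p \<and> r j < (r (Suc j) :: nat)"
  proof (rule dependent_nat_choice)
    show "\<exists>n. \<not> small_drops (M n) (X n) C \<eta> (1 / real (Suc 0)) p" using bad by blast
    show "\<exists>n. \<not> small_drops (M n) (X n) C \<eta> (1 / real (Suc (Suc j))) p \<and> m < n" for m j
      using bad[of "Suc m" "Suc j"] by (auto simp: Suc_le_eq)
  qed
  then obtain r where r: "\<And>j. \<not> small_drops (M (r j)) (X (r j)) C \<eta> (1 / real (Suc j)) p" "strict_mono r"
    by (auto simp: strict_mono_Suc_iff)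
  define Q where "Q j \<tau> \<longleftrightarrow> stopping_time (natural_filtration (M (r j)) (X (r j))) \<tau> \<and> finite (\<tau> ` space (M (r j))) \<and>
      (\<forall>\<omega>\<in>space (M (r j)). 0 \<le> \<tau> \<omega> \<and> \<tau> \<omega> \<le> C) \<and>
      p < measure (M (r j)) {\<omega>\<in>space (M (r j)). \<eta> < \<bar>square_mass (X (r j)) (\<tau> \<omega>) \<omega> - square_mass (X (r j)) (\<tau> \<omega> + 1 / real (Suc j)) \<omega>\<bar>}" for j \<tau>
  have "\<exists>\<tau>. Q j \<tau>" for j
    using r(1)[of j] unfolding small_drops_def Q_def not_all not_imp not_le by blast
  then have Q: "Q j (SOME \<tau>. Q j \<tau>)" for j by (rule someI_ex)
  define \<sigma> where "\<sigma> j = (SOME \<tau>. Q j \<tau>)" for j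
  have \<sigma>: "\<And>j. stopping_time (natural_filtration (M (r j)) (X (r j))) (\<sigma> j)"
      "\<And>j. finite (\<sigma> j ` space (M (r j)))"
      "\<And>j \<omega>. \<omega> \<in> space (M (r j)) \<Longrightarrow> 0 \<le> \<sigma> j \<omega> \<and> \<sigma> j \<omega> \<le> C"
      "\<And>j. p < measure (M (r j)) {\<omega>\<in>space (M (r j)). \<eta> < \<bar>square_mass (X (r j)) (\<sigma> j \<omega>) \<omega> - square_mass (X (r j)) (\<sigma> j \<omega> + 1 / real (Suc j)) \<omega>\<bar>}"
    using Q unfolding \<sigma>_def[symmetric] unfolding Q_def by blast+
  (* Off the range of r any admissible choice will do. *)
  define \<tau> where "\<tau> n = (if n \<in> range r then \<sigma> (inv r n) else (\<lambda>_. 0))" for n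
  define h where "h n = 1 / real (Suc (if n \<in> range r then inv r n else n))" for n
  have inj: "inv r (r j) = j" for j using r(2) by (simp add: strict_mono_imp_inj_on)
  have \<tau>_r: "\<tau> (r j) = \<sigma> j" for j unfolding \<tau>_def inj by simp
  have \<tau>_other: "\<tau> n = (\<lambda>_. 0)" if "n \<notin> range r" for n unfolding \<tau>_def using that by simp
  have st: "stopping_time (natural_filtration (M n) (X n)) (\<tau> n)" for n
    by (cases "n \<in> range r") (auto simp: \<tau>_r \<tau>_other stopping_time_const \<sigma>(1))
  have bound: "0 \<le> \<tau> n \<omega> \<and> \<tau> n \<omega> \<le> C" if "\<omega> \<in> space (M n)" for n \<omega>
  proof (cases "n \<in> range r")
    case True
    then obtain j where "n = r j" by auto
    then show ?thesis using \<sigma>(3) that by (simp add: \<tau>_r)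
  qed (simp add: \<tau>_other C)
  have fin\<tau>: "finite (\<tau> n ` space (M n))" for n
    by (cases "n \<in> range r") (auto simp: \<tau>_r \<tau>_other \<sigma>(2) image_constant_conv)
  have h0: "h \<longlonglongrightarrow> 0"
  proof (rule LIMSEQ_I)
    fix e :: real assume "0 < e"
    then obtain j0 where j0: "1 / real (Suc j0) < e" using nat_approx_posE by blast
    have "norm (h n - 0) < e" if n: "max (r j0) j0 \<le> n" for n
    proof -
      have "j0 \<le> (if n \<in> range r then inv r n else n)"
      proof (cases "n \<in> range r")
        case True
        then obtain j where j: "n = r j" by auto
        then have "r j0 \<le> r j" using n by auto
        then show ?thesis using r(2) by (simp add: strict_mono_less_eq j inj)
      qed (use n in auto)
      then have "h n \<le> 1 / real (Suc j0)" unfolding h_def by (simp add: frac_le)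
      moreover have "0 < h n" unfolding h_def by auto
      ultimately show ?thesis using j0 by simp
    qed
    then show "\<exists>no. \<forall>n\<ge>no. norm (h n - 0) < e" by blast
  qed
  have hpos: "0 < h n" for n unfolding h_def by auto
  let ?P = "\<lambda>n. measure (M n) {\<omega>\<in>space (M n). \<eta> < \<bar>square_mass (X n) (\<tau> n \<omega>) \<omega> - square_mass (X n) (\<tau> n \<omega> + h n) \<omega>\<bar>}"
  have large: "p < ?P (r j)" for j
  proof -
    have "h (r j) = 1 / real (Suc j)" unfolding h_def inj by simp
    then show ?thesis using \<sigma>(4)[of j] by (simp only: \<tau>_r)
  qed
  have "\<forall>\<^sub>F n in sequentially. ?P n \<le> p"
  proof -
    consider "tends_to_0_in_probability M
         (\<lambda>n \<omega>. enn2real (sum_squares (X n (\<tau> n \<omega>) \<omega>)) - enn2real (sum_squares (X n (\<tau> n \<omega> + h n) \<omega>)))"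
      | "\<forall>n. \<not> ((\<integral>\<^sup>+\<omega>. sum_squares (X n (\<tau> n \<omega>) \<omega>) \<partial>M n) = \<infinity> \<and> (\<integral>\<^sup>+\<omega>. sum_squares (X n (\<tau> n \<omega> + h n) \<omega>) \<partial>M n) = \<infinity>)"
        "(\<lambda>n. enn2ereal (\<integral>\<^sup>+\<omega>. sum_squares (X n (\<tau> n \<omega>) \<omega>) \<partial>M n)
              - enn2ereal (\<integral>\<^sup>+\<omega>. sum_squares (X n (\<tau> n \<omega> + h n) \<omega>) \<partial>M n)) \<longlonglongrightarrow> 0"
      using cond[of \<tau> h] st bound hpos h0 by blast
    then show ?thesis
    proof cases
      case 1
      then have "?P \<longlonglongrightarrow> 0" using \<eta> unfolding tends_to_0_in_probability_def square_mass_def by blast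
      then have "\<forall>\<^sub>F n in sequentially. ?P n < p" using p by (rule order_tendstoD)
      then show ?thesis by (rule eventually_mono) simp
    next
      case 2
      have "0 < ereal (p * \<eta>)" using p \<eta> by simp
      from order_tendstoD(2)[OF 2(2) this] show ?thesis
      proof eventually_elim
        case (elim n)
        have "\<tau> n \<in> borel_measurable (M n)"
          using st fragmentation_process_measurable[OF X] by (intro natural_stopping_time_measurable[of "X n"]) auto
        from drop_probability_le_expectation[OF M X fin this fin\<tau> _ less_imp_le[OF hpos] \<eta> _ elim]
        have "?P n \<le> p * \<eta> / \<eta>" using bound 2(1) by blast
        then show ?case using \<eta> by simp
      qed
    qed
  qed
  then obtain n0 where n0: "\<And>n. n0 \<le> n \<Longrightarrow> ?P n \<le> p" unfolding eventually_sequentially by blast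
  have "n0 \<le> r n0" using r(2) by (rule strict_mono_imp_increasing)
  then show False using n0[of "r n0"] large[of n0] by linarith
qed

section \<open>Successive drop times on a grid\<close>

text \<open>The successive grid indices at which \<open>q\<close> has dropped by more than \<open>\<eta>\<close> since the previous one, stopped
  at \<open>J\<close>. The second disjunct keeps \<^const>\<open>Least\<close> well defined and makes \<open>J\<close> absorbing.\<close>

primrec drop_index :: "(nat \<Rightarrow> real) \<Rightarrow> real \<Rightarrow> nat \<Rightarrow> nat \<Rightarrow> nat" where
  "drop_index q \<eta> J 0 = 0"
| "drop_index q \<eta> J (Suc i) =
    (LEAST j. drop_index q \<eta> J i < j \<and> \<eta> < q (drop_index q \<eta> J i) - q j \<or> J \<le> j)"

lemma drop_index_step:
  shows "(drop_index q \<eta> J i < drop_index q \<eta> J (Suc i) \<and>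
      \<eta> < q (drop_index q \<eta> J i) - q (drop_index q \<eta> J (Suc i))) \<or> J \<le> drop_index q \<eta> J (Suc i)"
    and "j < drop_index q \<eta> J (Suc i) \<Longrightarrow>
      \<not> ((drop_index q \<eta> J i < j \<and> \<eta> < q (drop_index q \<eta> J i) - q j) \<or> J \<le> j)"
proof -
  define P where "P j \<longleftrightarrow> (drop_index q \<eta> J i < j \<and> \<eta> < q (drop_index q \<eta> J i) - q j) \<or> J \<le> j" for j
  have Suc: "drop_index q \<eta> J (Suc i) = (LEAST j. P j)" unfolding P_def by simp
  have "P (drop_index q \<eta> J (Suc i))" unfolding Suc by (rule LeastI[of _ J]) (simp add: P_def)
  then show "(drop_index q \<eta> J i < drop_index q \<eta> J (Suc i) \<and>
      \<eta> < q (drop_index q \<eta> J i) - q (drop_index q \<eta> J (Suc i))) \<or> J \<le> drop_index q \<eta> J (Suc i)"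
    unfolding P_def .
  show "\<not> ((drop_index q \<eta> J i < j \<and> \<eta> < q (drop_index q \<eta> J i) - q j) \<or> J \<le> j)"
    if "j < drop_index q \<eta> J (Suc i)"
    using not_less_Least[of j P] that unfolding Suc P_def by blast
qed

lemma drop_index_le: "drop_index q \<eta> J i \<le> J"
proof (cases i)
  case (Suc i')
  then show ?thesis using drop_index_step(2)[of J q \<eta> J i'] by (meson not_le order_refl)
qed simp

lemma drop_index_mono: "drop_index q \<eta> J i \<le> drop_index q \<eta> J (Suc i)"
  using drop_index_step(1)[of q \<eta> J i] drop_index_le[of q \<eta> J i] by linarith

lemma drop_index_drop:
  "drop_index q \<eta> J (Suc i) < J \<Longrightarrow>
     \<eta> < q (drop_index q \<eta> J i) - q (drop_index q \<eta> J (Suc i))"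
  using drop_index_step(1)[of q \<eta> J i] by linarith

lemma drop_index_no_drop:
  assumes "drop_index q \<eta> J i \<le> j" "j < drop_index q \<eta> J (Suc i)" "0 \<le> \<eta>"
  shows "q (drop_index q \<eta> J i) - q j \<le> \<eta>"
  using drop_index_step(2)[OF assms(2)] assms by (cases "drop_index q \<eta> J i = j") auto

text \<open>The event that the index equals \<open>a\<close> depends on \<open>q\<close> up to \<open>a\<close> only. This is what makes the drop times
  stopping times.\<close>

lemma drop_index_measurable:
  assumes "\<And>j. j \<le> a \<Longrightarrow> (\<lambda>\<omega>. q \<omega> j) \<in> borel_measurable F"
  shows "Measurable.pred F (\<lambda>\<omega>. drop_index (q \<omega>) \<eta> J i = a)"
  using assms
proof (induction i arbitrary: a)
  case (Suc i)
  let ?P = "\<lambda>\<omega> b j. (b < j \<and> \<eta> < q \<omega> b - q \<omega> j) \<or> J \<le> j"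
  have eq: "drop_index (q \<omega>) \<eta> J (Suc i) = a \<longleftrightarrow>
      (\<exists>b\<in>{..a}. drop_index (q \<omega>) \<eta> J i = b \<and> ?P \<omega> b a \<and> (\<forall>c\<in>{..<a}. \<not> ?P \<omega> b c))" for \<omega>
  proof
    assume "drop_index (q \<omega>) \<eta> J (Suc i) = a"
    then show "\<exists>b\<in>{..a}. drop_index (q \<omega>) \<eta> J i = b \<and> ?P \<omega> b a \<and> (\<forall>c\<in>{..<a}. \<not> ?P \<omega> b c)"
      using drop_index_step(1)[of "q \<omega>" \<eta> J i] drop_index_step(2)[of _ "q \<omega>" \<eta> J i]
        drop_index_mono[of "q \<omega>" \<eta> J i] by auto
  next
    assume "\<exists>b\<in>{..a}. drop_index (q \<omega>) \<eta> J i = b \<and> ?P \<omega> b a \<and> (\<forall>c\<in>{..<a}. \<not> ?P \<omega> b c)"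
    then have "?P \<omega> (drop_index (q \<omega>) \<eta> J i) a" "\<And>c. c < a \<Longrightarrow> \<not> ?P \<omega> (drop_index (q \<omega>) \<eta> J i) c" by auto
    then show "drop_index (q \<omega>) \<eta> J (Suc i) = a"
      unfolding drop_index.simps by (intro Least_equality) (auto simp: not_less[symmetric])
  qed
  have lt: "Measurable.pred F (\<lambda>\<omega>. \<eta> < q \<omega> b - q \<omega> c)" if "b \<le> a" "c \<le> a" for b c
  proof -
    note Suc.prems[OF that(1), measurable] Suc.prems[OF that(2), measurable]
    show ?thesis by measurable
  qed
  show ?case
    unfolding eq
    by (intro pred_intros_finite pred_intros_logic lt Suc.IH Suc.prems measurable_const) auto
qed simp

locale fragmentation_grid =
  fixes M :: "'w measure" and X :: "real \<Rightarrow> 'w \<Rightarrow> (nat \<Rightarrow> real)" and g J :: nat and \<eta> :: real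
  assumes prob: "prob_space M" and X: "fragmentation_process M X"
    and finite_start: "AE \<omega> in M. sum_squares (X 0 \<omega>) < \<infinity>"
    and g: "0 < g" and \<eta>: "0 < \<eta>"
begin

definition drop_time :: "nat \<Rightarrow> 'w \<Rightarrow> real" where
  "drop_time i \<omega> = real (drop_index (\<lambda>j. square_mass X (real j / real g) \<omega>) \<eta> J i) / real g"

lemma drop_time_nonneg: "0 \<le> drop_time i \<omega>"
  unfolding drop_time_def by simp

lemma drop_time_0: "drop_time 0 \<omega> = 0"
  unfolding drop_time_def by simp

lemma drop_time_le: "drop_time i \<omega> \<le> real J / real g"
  unfolding drop_time_def by (intro divide_right_mono) (auto simp: drop_index_le)

lemma drop_time_mono: "i \<le> i' \<Longrightarrow> drop_time i \<omega> \<le> drop_time i' \<omega>"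
proof (rule lift_Suc_mono_le[of "\<lambda>i. drop_time i \<omega>"])
  show "drop_time i \<omega> \<le> drop_time (Suc i) \<omega>" for i
    unfolding drop_time_def by (intro divide_right_mono of_nat_mono drop_index_mono) auto
qed

text \<open>On a grid the drop times are stopping times of the raw filtration; first entrance times into open
  sets in continuous time would in general be so only after right-continuous augmentation.\<close>

lemma drop_time_stopping: "stopping_time (natural_filtration M X) (drop_time i)"
proof
  fix t :: real
  let ?F = "natural_filtration M X t"
  let ?\<kappa> = "\<lambda>\<omega>. drop_index (\<lambda>j. square_mass X (real j / real g) \<omega>) \<eta> J i"
  show "Measurable.pred ?F (\<lambda>\<omega>. drop_time i \<omega> \<le> t)"
  proof (cases "0 \<le> t")
    case False
    then have "\<not> drop_time i \<omega> \<le> t" for \<omega> using drop_time_nonneg[of i \<omega>] by linarith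
    then show ?thesis by simp
  next
    case True
    have eq: "drop_time i \<omega> \<le> t \<longleftrightarrow> (\<exists>a\<in>{..nat \<lfloor>real g * t\<rfloor>}. ?\<kappa> \<omega> = a)" for \<omega>
    proof -
      have "drop_time i \<omega> \<le> t \<longleftrightarrow> real (?\<kappa> \<omega>) \<le> real g * t"
        unfolding drop_time_def using g by (simp add: pos_divide_le_eq mult.commute)
      also have "\<dots> \<longleftrightarrow> ?\<kappa> \<omega> \<le> nat \<lfloor>real g * t\<rfloor>" using True by (simp add: le_nat_iff le_floor_iff)
      finally show ?thesis by auto
    qed
    have "(\<lambda>\<omega>. square_mass X (real j / real g) \<omega>) \<in> borel_measurable ?F" if "j \<le> nat \<lfloor>real g * t\<rfloor>" for j
    proof -
      have "real j \<le> real g * t" using that True by (simp add: le_nat_iff le_floor_iff)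
      then have "real j / real g \<le> t" using g by (simp add: pos_divide_le_eq mult.commute)
      then have [measurable]: "X (real j / real g) \<in> borel_measurable ?F"
        by (intro natural_filtration_measurable) auto
      show ?thesis unfolding square_mass_def by measurable
    qed
    then show ?thesis unfolding eq by (intro pred_intros_finite drop_index_measurable) auto
  qed
qed

lemma drop_time_finite_range: "finite (drop_time i ` space M)"
proof (rule finite_subset)
  show "drop_time i ` space M \<subseteq> (\<lambda>a. real a / real g) ` {..J}"
    unfolding drop_time_def using drop_index_le by auto
qed simp

lemma X_measurable: "0 \<le> s \<Longrightarrow> X s \<in> borel_measurable M"
  by (rule fragmentation_process_measurable[OF X])

lemma drop_time_measurable [measurable]: "drop_time i \<in> borel_measurable M"
  by (rule natural_stopping_time_measurable[OF X_measurable drop_time_stopping])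

text \<open>Monotonicity of \<open>Q\<close> is decisive: if the next drop comes within \<open>\<delta>\<close>, the whole loss has occurred
  by the deterministic lag \<open>\<delta>\<close>, so that the hypothesis on small drops applies directly. The condition
  \<open>g * (T + 1) \<le> J\<close> ensures that the next drop time is a genuine drop and not the cap \<open>J\<close>.\<close>

lemma probability_early_short_gap:
  assumes small: "small_drops M X C \<eta> \<delta> p" and \<delta>: "0 < \<delta>" "\<delta> \<le> 1"
    and J: "real g * (T + 1) \<le> real J" "real J \<le> real g * C"
  shows "measure M {\<omega>\<in>space M. drop_time i \<omega> < T \<and> drop_time (Suc i) \<omega> \<le> drop_time i \<omega> + \<delta>} \<le> p"
proof -
  interpret prob_space M by (rule prob)
  have at: "(\<lambda>\<omega>. X (drop_time i \<omega> + h) \<omega>) \<in> borel_measurable M" if "0 \<le> h" for h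
    by (rule measurable_at_simple_time[OF X_measurable drop_time_measurable drop_time_finite_range drop_time_nonneg that])
  note at[OF less_imp_le[OF \<delta>(1)], measurable]
  have [measurable]: "(\<lambda>\<omega>. X (drop_time i \<omega>) \<omega>) \<in> borel_measurable M"
    using at[OF order_refl] by simp
  have "real J / real g \<le> C" using J(2) g by (simp add: pos_divide_le_eq mult.commute)
  then have C: "drop_time i \<omega> \<le> C" for \<omega> by (rule order_trans[OF drop_time_le])
  have "measure M {\<omega>\<in>space M. drop_time i \<omega> < T \<and> drop_time (Suc i) \<omega> \<le> drop_time i \<omega> + \<delta>}
      \<le> measure M {\<omega>\<in>space M. \<eta> < \<bar>square_mass X (drop_time i \<omega>) \<omega> - square_mass X (drop_time i \<omega> + \<delta>) \<omega>\<bar>}"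
  proof (rule finite_measure_mono_AE)
    show "AE \<omega> in M. \<omega> \<in> {\<omega>\<in>space M. drop_time i \<omega> < T \<and> drop_time (Suc i) \<omega> \<le> drop_time i \<omega> + \<delta>} \<longrightarrow>
        \<omega> \<in> {\<omega>\<in>space M. \<eta> < \<bar>square_mass X (drop_time i \<omega>) \<omega> - square_mass X (drop_time i \<omega> + \<delta>) \<omega>\<bar>}"
      using finite_start
    proof eventually_elim
      case (elim \<omega>)
      show ?case
      proof
        assume *: "\<omega> \<in> {\<omega>\<in>space M. drop_time i \<omega> < T \<and> drop_time (Suc i) \<omega> \<le> drop_time i \<omega> + \<delta>}"
        let ?q = "\<lambda>j. square_mass X (real j / real g) \<omega>"
        have "drop_time (Suc i) \<omega> < T + 1" using * \<delta> by auto
        then have "real (drop_index ?q \<eta> J (Suc i)) < real g * (T + 1)"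
          unfolding drop_time_def using g by (simp add: pos_divide_less_eq mult.commute)
        then have "drop_index ?q \<eta> J (Suc i) < J" using J(1) by linarith
        from drop_index_drop[OF this]
        have "\<eta> < square_mass X (drop_time i \<omega>) \<omega> - square_mass X (drop_time (Suc i) \<omega>) \<omega>"
          unfolding drop_time_def .
        moreover have "square_mass X (drop_time i \<omega> + \<delta>) \<omega> \<le> square_mass X (drop_time (Suc i) \<omega>) \<omega>"
          using * elim by (intro square_mass_antimono[OF X]) (auto simp: drop_time_nonneg)
        ultimately show "\<omega> \<in> {\<omega>\<in>space M. \<eta> < \<bar>square_mass X (drop_time i \<omega>) \<omega> - square_mass X (drop_time i \<omega> + \<delta>) \<omega>\<bar>}"
          using * by auto
      qed
    qed
    show "{\<omega>\<in>space M. \<eta> < \<bar>square_mass X (drop_time i \<omega>) \<omega> - square_mass X (drop_time i \<omega> + \<delta>) \<omega>\<bar>} \<in> sets M"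
      unfolding square_mass_def by measurable
  qed
  also have "\<dots> \<le> p"
    using small drop_time_stopping drop_time_finite_range drop_time_nonneg C unfolding small_drops_def by blast
  finally show ?thesis .
qed

text \<open>If the \<open>q\<close>-th drop comes before \<open>T\<close>, at most \<open>T / \<delta>\<close> of the first \<open>q\<close> gaps exceed \<open>\<delta>\<close>, so at least half
  of them are short. The expected number of early short gaps is at most \<open>q * p\<close>.\<close>

lemma probability_many_early_drops:
  assumes gaps: "\<And>i. measure M {\<omega>\<in>space M. drop_time i \<omega> < T \<and> drop_time (Suc i) \<omega> \<le> drop_time i \<omega> + \<delta>} \<le> p"
    and \<delta>: "0 < \<delta>" and q: "0 < q" "2 * T / \<delta> \<le> real q"
  shows "measure M {\<omega>\<in>space M. drop_time q \<omega> < T} \<le> 2 * p"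
proof -
  interpret prob_space M by (rule prob)
  define A where "A i = {\<omega>\<in>space M. drop_time i \<omega> < T \<and> drop_time (Suc i) \<omega> \<le> drop_time i \<omega> + \<delta>}" for i
  define B where "B = {\<omega>\<in>space M. drop_time q \<omega> < T}"
  have [measurable]: "A i \<in> sets M" "B \<in> sets M" for i unfolding A_def B_def by measurable
  have count: "real q / 2 * indicator B \<omega> \<le> (\<Sum>i<q. indicator (A i) \<omega>)" if \<omega>: "\<omega> \<in> space M" for \<omega>
  proof (cases "\<omega> \<in> B")
    case True
    (* A gap that is not short and early exceeds \<delta>, because on B all the drop times are early. *)
    have gap: "\<delta> * (1 - indicator (A i) \<omega>) \<le> drop_time (Suc i) \<omega> - drop_time i \<omega>" if "i < q" for i
    proof (cases "\<omega> \<in> A i")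
      case False
      have "drop_time i \<omega> < T" using True drop_time_mono[of i q \<omega>] that unfolding B_def by auto
      then show ?thesis using False \<omega> unfolding A_def by auto
    qed (use drop_time_mono[of i "Suc i" \<omega>] in auto)
    have "\<delta> * (real q - (\<Sum>i<q. indicator (A i) \<omega>)) = (\<Sum>i<q. \<delta> * (1 - indicator (A i) \<omega>))"
      by (simp add: sum_distrib_left[symmetric] sum_subtractf)
    also have "\<dots> \<le> (\<Sum>i<q. drop_time (Suc i) \<omega> - drop_time i \<omega>)" using gap by (intro sum_mono) auto
    also have "\<dots> = drop_time q \<omega>" by (subst sum_lessThan_telescope) (simp add: drop_time_0)
    also have "\<dots> \<le> T" using True unfolding B_def by auto
    finally have "real q - (\<Sum>i<q. indicator (A i) \<omega>) \<le> T / \<delta>"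
      using \<delta> by (simp add: pos_le_divide_eq mult.commute)
    moreover have "2 * (T / \<delta>) \<le> real q" using q(2) by (simp only: times_divide_eq_right)
    ultimately have "real q / 2 \<le> (\<Sum>i<q. indicator (A i) \<omega>)" by linarith
    then show ?thesis using True by simp
  qed (simp add: sum_nonneg)
  have "real q / 2 * measure M B = (\<integral>\<omega>. real q / 2 * indicator B \<omega> \<partial>M)" by simp
  also have "\<dots> \<le> (\<integral>\<omega>. (\<Sum>i<q. indicator (A i) \<omega>) \<partial>M)"
    by (intro integral_mono count) (auto simp: less_top[symmetric])
  also have "\<dots> = (\<Sum>i<q. measure M (A i))"
    by (subst Bochner_Integration.integral_sum) (auto simp: less_top[symmetric])
  also have "\<dots> \<le> (\<Sum>i<q. p)" using gaps unfolding A_def by (intro sum_mono)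
  finally have "real q * measure M B \<le> real q * (2 * p)" by simp
  then show ?thesis using q(1) unfolding B_def[symmetric] by simp
qed

lemma discretize_drop_time_oscillation:
  assumes \<omega>: "\<omega> \<in> space M" and start: "sum_squares (X 0 \<omega>) < \<infinity>" and small: "\<eta> < c\<^sup>2" "0 \<le> c"
    and J: "real J \<le> real g * real g"
    and a: "a \<in> {drop_time i \<omega>..<drop_time (Suc i) \<omega>}"
  shows "dist (X (drop_time i \<omega>) \<omega>) (discretize g (sample_path X \<omega>) a) \<le> 2 * c"
proof -
  let ?q = "\<lambda>j. square_mass X (real j / real g) \<omega>"
  let ?\<kappa> = "drop_index ?q \<eta> J"
  have a0: "0 \<le> a" using a drop_time_nonneg[of i \<omega>] by auto
  define m where "m = nat \<lfloor>real g * a\<rfloor>"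
  have "real (?\<kappa> i) \<le> real g * a" using a g unfolding drop_time_def by (simp add: pos_divide_le_eq mult.commute)
  then have m1: "?\<kappa> i \<le> m" unfolding m_def by (simp add: le_nat_iff le_floor_iff a0)
  have ga: "real g * a < real (?\<kappa> (Suc i))" using a g unfolding drop_time_def by (simp add: pos_less_divide_eq mult.commute del: drop_index.simps)
  have "real m \<le> real g * a" unfolding m_def using a0 by simp
  then have m2: "m < ?\<kappa> (Suc i)" using ga by linarith
  have "real (?\<kappa> (Suc i)) \<le> real (g * g)" using J drop_index_le[of ?q \<eta> J "Suc i"] by (simp del: drop_index.simps)
  then have "m \<le> g * g" using m2 by linarith
  then have disc: "discretize g (sample_path X \<omega>) a = X (real m / real g) \<omega>"
    unfolding discretize_def grid_path_def sample_path_def m_def using a0 by (simp add: min_absorb1)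
  have "?q (?\<kappa> i) - ?q m \<le> \<eta>" using drop_index_no_drop[OF m1 m2] \<eta> by simp
  then show ?thesis
    unfolding disc drop_time_def using small m1 g
    by (intro fragmentation_dist_le[OF X \<omega> start]) (auto intro: divide_right_mono)
qed

end

lemma discretize_discretize:
  assumes "0 < k" "0 < j"
  shows "discretize k (discretize (k * j) x) = discretize k x"
proof -
  have "discretize (k * j) x (real i / real k) = x (real i / real k)" if "i \<le> k * k" for i
  proof -
    have "real (k * j) * (real i / real k) = real (j * i)" using assms by simp
    then have "nat \<lfloor>real (k * j) * (real i / real k)\<rfloor> = j * i" by (metis floor_of_nat nat_int)
    moreover have "j * i \<le> (k * j) * (k * j)"
    proof -
      have "j * i \<le> j * (k * k)" using that by (rule mult_le_mono2)
      also have "\<dots> \<le> j * (k * k) * j" using assms by simp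
      finally show ?thesis by (simp add: algebra_simps)
    qed
    ultimately have "discretize (k * j) x (real i / real k) = x (real (j * i) / real (k * j))"
      unfolding discretize_def[of "k * j"] grid_path_def by (simp add: min_absorb1)
    then show ?thesis using assms by simp
  qed
  then show ?thesis unfolding discretize_def[of k] grid_path_def by (auto intro!: ext)
qed

text \<open>The lag \<open>\<delta>\<^sub>1\<close> bounds the number \<open>q\<close> of drops before the horizon, and the smaller lag \<open>\<delta>\<^sub>2\<close> separates these
  \<open>q\<close> drops with a failure probability that stays small after summing over them. Off the exceptional
  event the drop times form a partition with cells longer than \<open>1 / k\<close>. They
  live on the finer grid, so they control the path sampled on that grid throughout each cell.\<close>

lemma probability_discretizations_close:
  fixes M :: "'w measure"
  assumes prob: "prob_space M" and X: "fragmentation_process M X"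
    and fin: "AE \<omega> in M. sum_squares (X 0 \<omega>) < \<infinity>"
    and T: "0 \<le> T" and d: "0 < d" and pos: "0 < \<eta>" and less: "\<eta> < (d / 8)\<^sup>2"
    and small1: "small_drops M X (T + 4) \<eta> \<delta>\<^sub>1 p\<^sub>1" "0 < \<delta>\<^sub>1" "\<delta>\<^sub>1 \<le> 1"
    and small2: "small_drops M X (T + 4) \<eta> \<delta>\<^sub>2 p\<^sub>2" "0 < \<delta>\<^sub>2" "\<delta>\<^sub>2 \<le> 1"
    and q: "0 < q" "2 * (T + 2) / \<delta>\<^sub>1 \<le> real q"
    and k: "1 / real k \<le> \<delta>\<^sub>2" "1 / real k < d" "T + 4 \<le> real k" and j: "0 < j"
  shows "\<exists>G\<in>sets M. measure M (space M - G) \<le> 2 * p\<^sub>1 + real q * p\<^sub>2 \<and>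
    (\<forall>\<omega>\<in>G. discretize (k * j) (sample_path X \<omega>) \<in> skorohod_nbhd Sdown (discretize k (sample_path X \<omega>)) T d)"
proof -
  interpret prob_space M by (rule prob)
  define g where "g = k * j"
  have k0: "0 < k" using k(3) T by (cases k) auto
  have g: "0 < g" using k0 j unfolding g_def by auto
  have "k * 1 \<le> k * j" using j by (intro mult_le_mono2) simp
  then have gk: "real k \<le> real g" unfolding g_def by (simp only: mult_1_right of_nat_mono)
  (* The drop times must pass T + 2 to give a partition beyond T + 1; one further unit is for the lag,
     and the rounding of the cap J costs at most another one, whence the bound T + 4. *)
  define J where "J = nat \<lceil>real g * (T + 3)\<rceil>"
  have J1: "real g * (T + 2 + 1) \<le> real J"
    unfolding J_def by (simp add: algebra_simps) linarith
  have "real J \<le> real g * (T + 3) + 1"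
  proof -
    have "0 \<le> real g * (T + 3)" using T by simp
    then show ?thesis unfolding J_def by linarith
  qed
  also have "\<dots> \<le> real g * (T + 3) + real g" using g by simp
  finally have J2: "real J \<le> real g * (T + 4)" by (simp add: algebra_simps)
  have J3: "real J \<le> real g * real g"
    using J2 mult_left_mono[of "T + 4" "real g" "real g"] k(3) gk by linarith
  interpret fragmentation_grid M X g J \<eta>
    by unfold_locales (fact prob X fin g pos)+
  define A where "A i = {\<omega>\<in>space M. drop_time i \<omega> < T + 2 \<and> drop_time (Suc i) \<omega> \<le> drop_time i \<omega> + \<delta>\<^sub>2}" for i
  define B where "B = {\<omega>\<in>space M. drop_time q \<omega> < T + 2}"
  define Z where "Z = {\<omega>\<in>space M. \<not> sum_squares (X 0 \<omega>) < \<infinity>}"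
  have [measurable]: "X 0 \<in> borel_measurable M" by (rule X_measurable) simp
  have [measurable]: "A i \<in> sets M" "B \<in> sets M" "Z \<in> sets M" for i
    unfolding A_def B_def Z_def by measurable
  have PA: "measure M (A i) \<le> p\<^sub>2" for i
    unfolding A_def by (rule probability_early_short_gap[OF small2 J1 J2])
  have PB: "measure M B \<le> 2 * p\<^sub>1"
    unfolding B_def using probability_early_short_gap[OF small1 J1 J2] small1(2) q
    by (rule probability_many_early_drops)
  have PZ: "measure M Z = 0"
    unfolding Z_def using fin by (intro measure_eq_0_null_sets) (simp add: AE_iff_null)
  define bad where "bad = Z \<union> (B \<union> (\<Union>i<q. A i))"
  have bad: "bad \<in> sets M" unfolding bad_def by measurable
  have "measure M bad \<le> measure M Z + (measure M B + (\<Sum>i<q. measure M (A i)))"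
    unfolding bad_def
    by (intro order_trans[OF measure_Un_le] add_left_mono measure_UNION_le) auto
  also have "\<dots> \<le> 0 + (2 * p\<^sub>1 + (\<Sum>i<q. p\<^sub>2))"
    using PZ PB PA by (intro add_mono sum_mono) auto
  finally have Pbad: "measure M bad \<le> 2 * p\<^sub>1 + real q * p\<^sub>2" by simp
  have close: "discretize g (sample_path X \<omega>) \<in> skorohod_nbhd Sdown (discretize k (sample_path X \<omega>)) T d"
    if \<omega>: "\<omega> \<in> space M - bad" for \<omega>
  proof -
    have \<omega>M: "\<omega> \<in> space M" and start: "sum_squares (X 0 \<omega>) < \<infinity>"
      and "\<not> drop_time q \<omega> < T + 2" and noA: "\<And>i. i < q \<Longrightarrow> \<omega> \<notin> A i"
      using \<omega> unfolding bad_def Z_def B_def by auto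
    define r where "r = (LEAST r. T + 2 \<le> drop_time r \<omega>)"
    have q': "T + 2 \<le> drop_time q \<omega>" using \<open>\<not> drop_time q \<omega> < T + 2\<close> by simp
    have r: "T + 2 \<le> drop_time r \<omega>" unfolding r_def using q' by (rule LeastI)
    have rq: "r \<le> q" unfolding r_def using q' by (rule Least_le)
    have early: "drop_time i \<omega> < T + 2" if "i < r" for i
      using not_less_Least[of i "\<lambda>r. T + 2 \<le> drop_time r \<omega>"] that unfolding r_def by auto
    have "discretize g (sample_path X \<omega>)
        \<in> skorohod_nbhd Sdown (discretize k (discretize g (sample_path X \<omega>))) T d"
    proof (rule discretize_nbhd_of_partition[where t = "\<lambda>i. drop_time i \<omega>" and r = r])
      show "discretize g (sample_path X \<omega>) \<in> cadlag_paths Sdown"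
        by (intro discretize_cadlag g fragmentation_process_path[OF X \<omega>M])
      show "drop_time i \<omega> + 1 / real k \<le> drop_time (Suc i) \<omega>" if "i < r" for i
        using noA[of i] early[OF that] that rq \<omega>M k(1) unfolding A_def by auto
      show "dist (discretize g (sample_path X \<omega>) a) (discretize g (sample_path X \<omega>) b) < d"
        if "i < r" "a \<in> {drop_time i \<omega>..<drop_time (Suc i) \<omega>}" "b \<in> {drop_time i \<omega>..<drop_time (Suc i) \<omega>}" for i a b
        using discretize_drop_time_oscillation[OF \<omega>M start less _ J3 that(2)]
          discretize_drop_time_oscillation[OF \<omega>M start less _ J3 that(3)] d
          dist_triangle3[of "discretize g (sample_path X \<omega>) a" "discretize g (sample_path X \<omega>) b" "X (drop_time i \<omega>) \<omega>"]
        by auto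
    qed (use k k0 T r drop_time_0 in auto)
    then show ?thesis unfolding g_def discretize_discretize[OF k0 j] .
  qed
  show ?thesis
    using bad Pbad close sets.sets_into_space[OF bad]
    by (intro bexI[of _ "space M - bad"]) (auto simp: g_def double_diff)
qed

section \<open>Convergence of fragmentation processes\<close>

theorem theorem3p3:
  fixes M :: "nat \<Rightarrow> 'w measure" and X :: "nat \<Rightarrow> real \<Rightarrow> 'w \<Rightarrow> (nat \<Rightarrow> real)"
    and N :: "'v measure" and Y :: "real \<Rightarrow> 'v \<Rightarrow> (nat \<Rightarrow> real)"
  assumes "\<And>n. prob_space (M n)" and "prob_space N"
    and "\<And>n. fragmentation_process (M n) (X n)"
    and "cadlag_process N Sdown Y"
    and "converges_in_fdd Sdown M X N Y"
    and "\<And>n. AE \<omega> in M n. sum_squares (X n 0 \<omega>) < \<infinity>"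
    and "\<And>(\<tau> :: nat \<Rightarrow> 'w \<Rightarrow> real) (h :: nat \<Rightarrow> real).
       (\<forall>n. stopping_time (natural_filtration (M n) (X n)) (\<tau> n)) \<Longrightarrow>
       (\<exists>C. \<forall>n. \<forall>\<omega>\<in>space (M n). 0 \<le> \<tau> n \<omega> \<and> \<tau> n \<omega> \<le> C) \<Longrightarrow>
       (\<forall>n. 0 < h n) \<Longrightarrow> h \<longlonglongrightarrow> 0 \<Longrightarrow>
       tends_to_0_in_probability M
         (\<lambda>n \<omega>. enn2real (sum_squares (X n (\<tau> n \<omega>) \<omega>)) - enn2real (sum_squares (X n (\<tau> n \<omega> + h n) \<omega>)))
       \<or> ((\<forall>n. \<not> ((\<integral>\<^sup>+\<omega>. sum_squares (X n (\<tau> n \<omega>) \<omega>) \<partial>M n) = \<infinity> \<and> (\<integral>\<^sup>+\<omega>. sum_squares (X n (\<tau> n \<omega> + h n) \<omega>) \<partial>M n) = \<infinity>)) \<and>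
          (\<lambda>n. enn2ereal (\<integral>\<^sup>+\<omega>. sum_squares (X n (\<tau> n \<omega>) \<omega>) \<partial>M n)
              - enn2ereal (\<integral>\<^sup>+\<omega>. sum_squares (X n (\<tau> n \<omega> + h n) \<omega>) \<partial>M n)) \<longlonglongrightarrow> 0)"
  shows "converges_in_distribution (skorohod_topology Sdown)
           M (\<lambda>n. sample_path (X n)) N (sample_path Y)"
proof -
  have pathX: "sample_path (X n) \<omega> \<in> cadlag_paths Sdown" if "\<omega> \<in> space (M n)" for n \<omega>
    using fragmentation_process_path[OF assms(3) that] .
  have pathY: "sample_path Y \<omega> \<in> cadlag_paths Sdown" if "\<omega> \<in> space N" for \<omega>
    using assms(4) that unfolding cadlag_process_def by blast
  have measX: "fdd_measurable (M n) Sdown (X n)" for n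
    by (rule converges_in_fdd_measurable(1)[OF assms(5) pathX pathY])
  have measY: "fdd_measurable N Sdown Y"
    by (rule converges_in_fdd_measurable(2)[OF assms(5) pathX pathY])
  have unif: "\<exists>k0 n0. \<forall>k\<ge>k0. \<forall>n\<ge>n0. \<forall>j>0. \<exists>G\<in>sets (M n).
        measure (M n) (space (M n) - G) \<le> e \<and>
        (\<forall>\<omega>\<in>G. discretize (k * j) (sample_path (X n) \<omega>)
          \<in> skorohod_nbhd Sdown (discretize k (sample_path (X n) \<omega>)) T d)"
    if d: "0 < d" and e: "0 < e" for T d e
  proof -
    define T' where "T' = max T 0"
    have T': "0 \<le> T'" "T \<le> T'" unfolding T'_def by auto
    (* A drop below (d / 8)\<^sup>2 moves the path by at most d / 4, so two points of a cell are d / 2 close. *)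
    define \<eta> where "\<eta> = (d / 8)\<^sup>2 / 2"
    have \<eta>: "0 < \<eta>" "\<eta> < (d / 8)\<^sup>2" using d unfolding \<eta>_def by auto
    have C: "0 \<le> T' + 4" using T' by simp
    have p1: "0 < e / 4" using e by simp
    obtain \<delta>\<^sub>1 n1 where \<delta>1: "0 < \<delta>\<^sub>1" "\<delta>\<^sub>1 \<le> 1"
      "\<And>n. n1 \<le> n \<Longrightarrow> small_drops (M n) (X n) (T' + 4) \<eta> \<delta>\<^sub>1 (e / 4)"
      using uniformly_small_drops[where M = M and X = X, OF assms(1,3,6,7) C \<eta>(1) p1] by blast
    define q where "q = Suc (nat \<lceil>2 * (T' + 2) / \<delta>\<^sub>1\<rceil>)"
    have q: "0 < q" "2 * (T' + 2) / \<delta>\<^sub>1 \<le> real q" unfolding q_def by (simp, linarith)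
    have p2: "0 < e / (2 * real q)" using e q by simp
    obtain \<delta>\<^sub>2 n2 where \<delta>2: "0 < \<delta>\<^sub>2" "\<delta>\<^sub>2 \<le> 1"
      "\<And>n. n2 \<le> n \<Longrightarrow> small_drops (M n) (X n) (T' + 4) \<eta> \<delta>\<^sub>2 (e / (2 * real q))"
      using uniformly_small_drops[where M = M and X = X, OF assms(1,3,6,7) C \<eta>(1) p2] by blast
    have total: "2 * (e / 4) + real q * (e / (2 * real q)) = e" using q(1) by simp
    have "\<forall>\<^sub>F k in sequentially. 1 / real k < min \<delta>\<^sub>2 d"
      using lim_1_over_n[where 'a = real] \<delta>2(1) d by (intro order_tendstoD(2)) auto
    moreover have "\<forall>\<^sub>F k in sequentially. T' + 4 \<le> real k"
      using eventually_ge_at_top[of "nat \<lceil>T' + 4\<rceil>"] by eventually_elim linarith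
    ultimately have "\<forall>\<^sub>F k in sequentially. 1 / real k < min \<delta>\<^sub>2 d \<and> T' + 4 \<le> real k"
      by (rule eventually_conj)
    then obtain k0 where k0: "\<And>k. k0 \<le> k \<Longrightarrow> 1 / real k < min \<delta>\<^sub>2 d \<and> T' + 4 \<le> real k"
      unfolding eventually_sequentially by blast
    show ?thesis
    proof (rule exI[of _ k0], rule exI[of _ "max n1 n2"], intro allI impI)
      fix k n j :: nat assume *: "k0 \<le> k" "max n1 n2 \<le> n" "0 < j"
      have k: "1 / real k \<le> \<delta>\<^sub>2" "1 / real k < d" "T' + 4 \<le> real k" using k0[OF *(1)] by auto
      have n: "n1 \<le> n" "n2 \<le> n" using *(2) by auto
      have mono: "skorohod_nbhd Sdown x T' d \<subseteq> skorohod_nbhd Sdown x T d" for x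
        using T'(2) by (intro skorohod_nbhd_mono) auto
      obtain G where G: "G \<in> sets (M n)" "measure (M n) (space (M n) - G) \<le> e"
        "\<forall>\<omega>\<in>G. discretize (k * j) (sample_path (X n) \<omega>)
          \<in> skorohod_nbhd Sdown (discretize k (sample_path (X n) \<omega>)) T' d"
        using probability_discretizations_close[OF assms(1,3,6) T'(1) d \<eta> \<delta>1(3)[OF n(1)] \<delta>1(1,2)
            \<delta>2(3)[OF n(2)] \<delta>2(1,2) q k *(3)]
        unfolding total by (elim bexE conjE)
      show "\<exists>G\<in>sets (M n). measure (M n) (space (M n) - G) \<le> e \<and>
        (\<forall>\<omega>\<in>G. discretize (k * j) (sample_path (X n) \<omega>)
          \<in> skorohod_nbhd Sdown (discretize k (sample_path (X n) \<omega>)) T d)"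
        using G mono by (intro bexI[of _ G] conjI ballI) auto
    qed
  qed
  show ?thesis
  proof (rule skorohod_convergence_of_ucont[OF assms(1,2) measX measY])
    fix h and B :: real
    assume h: "skorohod_ucont Sdown h" and B: "\<And>x. x \<in> cadlag_paths Sdown \<Longrightarrow> \<bar>h x\<bar> \<le> B"
    show "(\<lambda>n. \<integral>\<omega>. h (sample_path (X n) \<omega>) \<partial>M n) \<longlonglongrightarrow> (\<integral>\<omega>. h (sample_path Y \<omega>) \<partial>N)"
      by (rule skorohod_ucont_integral_convergence[OF assms(1,2) measX measY assms(5) unif h B])
  qed
qed

end
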